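(* Let $(R,\mathfrak{m})$ be a finite commutative local ring with identity, with $m=|\mathfrak{m}|=q^{\beta}$ and residue field $R/\mathfrak{m}\simeq\mathbb{F}_q$. Let $k\in\mathbb{N}$ be such that $k\mid\frac{q-1}{2}$ if $q$ is odd, or $k\mid q-1$ if $q$ is even. Then: (a) ($k=2$) If $q\equiv 1\pmod 4$, then $\mathcal{K}_3(G_R(2))=\dfrac{q^{3\beta+1}(q-1)(q-5)}{48}$. (b) ($k=3$) Let $q=p^r$ with $p$ prime, such that $3\mid q-1$ if $q$ is even, or $6\mid q-1$ if $q$ is odd. When $p\equiv 1\pmod 3$, write $4q=c^2+27d^2$ with $c,d\in\mathbb{Z}$, $c\equiv 1\pmod 3$ and $p\nmid c$. When $p\equiv 2\pmod 3$, let $c=-2(-p)^{r/2}$. Then $\mathcal{K}_3(G_R(3))=\dfrac{q^{3\beta+1}(q-1)(q+c-8)}{162}$. (c) ($k=4$) Let $q=p^r\equiv 1\pmod 8$ with $p$ prime. Write $q=e^2+4f^2$ with $e,f\in\mathbb{Z}$, $e\equiv 1\pmod 4$, and $p\nmid e$ when $p\equiv 1\pmod 4$. Then $\mathcal{K}_3(G_R(4))=\dfrac{q^{3\beta+1}(q-1)(q-6e-11)}{2^7\cdot 3}$.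
   Context: For a finite commutative ring $R$ with identity and $k\in\mathbb{N}$, let $U_R(k)=\{x^k: x\in R^*\}$ and $G_R(k)=\mathrm{Cay}(R,U_R(k))$, the (undirected, under the hypotheses) Cayley graph on vertex set $R$ in which $v,w$ are adjacent iff $w-v\in U_R(k)$. For a graph $H$, $\mathcal{K}_{\ell}(H)$ denotes the number of cliques (complete subgraphs) of $H$ with exactly $\ell$ vertices. *)

theory Defs
  imports
    "HOL-Algebra.QuotRing"
    "HOL-Number_Theory.Cong"
    "HOL-Computational_Algebra.Primes"
    "HOL.Real"
    "Graph_Theory.Kuratowski"
begin

locale local_ring = cring R + maximalideal M R for R (structure) and M +
  assumes unique_maximalideal: "\<And>J. maximalideal J R \<Longrightarrow> J = M"

definition unit_powers :: "('a, 'b) ring_scheme \<Rightarrow> nat \<Rightarrow> 'a set" where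
  "unit_powers R k = {x [^]\<^bsub>R\<^esub> k | x. x \<in> Units R}"

definition cayley_graph :: "('a, 'b) ring_scheme \<Rightarrow> 'a set \<Rightarrow> 'a pair_pre_digraph" where
  "cayley_graph R S =
     \<lparr> pverts = carrier R,
       parcs = {(v, w). v \<in> carrier R \<and> w \<in> carrier R \<and> w \<ominus>\<^bsub>R\<^esub> v \<in> S} \<rparr>"

definition unit_power_graph :: "('a, 'b) ring_scheme \<Rightarrow> nat \<Rightarrow> 'a pair_pre_digraph" where
  "unit_power_graph R k = cayley_graph R (unit_powers R k)"

(* Graph_Theory represents an undirected graph as a symmetric digraph, and complete_digraph
   demands this of H. A subgraph keeps the tail and head functions of G, so each clique is
   counted once. *)
definition num_cliques :: "nat \<Rightarrow> ('a, 'b) pre_digraph \<Rightarrow> nat" where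
  "num_cliques l G = card {H. subgraph H G \<and> complete_digraph l H}"

end

theory Submission
  imports Defs "HOL-Algebra.Multiplicative_Group" "HOL-Number_Theory.Number_Theory" Complex_Main
begin

text \<open>
  Since \<open>k\<close> is coprime to \<open>q\<close>, the group \<open>1 + M\<close> consists of \<open>k\<close>-th powers, so the \<open>k\<close>-th powers of
  units of \<open>R\<close> are exactly the preimage of those of the residue field \<open>F\<close>. Counting ordered
  triangles through the origin reduces the statement to the cyclotomic number
  \<open>\<lambda> = card {x \<in> U. 1 - x \<in> U}\<close>, where \<open>U\<close> is the group of nonzero \<open>k\<close>-th powers in \<open>F\<close>.

  Expanding the indicator of \<open>U\<close> in complex characters of order \<open>k\<close> expresses \<open>k\<^sup>2 \<lambda>\<close> through the
  Jacobi sum \<open>J(\<chi>, \<chi>)\<close>. It lies in the ring of Eisenstein or Gaussian integers and has norm \<open>q\<close>,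
  which gives a representation of \<open>q\<close> by a quadratic form. To see that this representation is the
  given one, it remains to show (when \<open>p\<close> splits) that \<open>p\<close> does not divide its first entry: expanding
  the same indicator in characters with values in \<open>F\<close> itself shows that this entry is, modulo \<open>p\<close>,
  a unit times a binomial coefficient prime to \<open>p\<close>. When \<open>p\<close> is inert, descent forces the representation.
\<close>

section \<open>Representations by quadratic forms\<close>

text \<open>If p splits, q = p^r is a norm in several essentially different ways, one for each
  distribution of the r prime factors between a prime above p and its conjugate. The norm of J(chi,
  chi) cannot tell these apart; requiring the first entry to be prime to p singles out, up to signs,
  the one in which only one of the two primes occurs. Classically Stickelberger's congruence
  supplies this for Jacobi sums. Characters x -> x^((q-1)/k) valued in F replace it and avoid prime
  ideals: equating the two evaluations of the same integer modulo p ties the real part of J to a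
  binomial coefficient, and the base-p digits of (q-1)/k show that this is prime to p. The signs and
  the divisibility of the second entry come from the integrality of the count and the norm equation,
  with no separate congruence for J. That -1 is a k-th power, which the divisibility hypothesis on k
  secures, makes the graph symmetric and gives chi(-1) = 1, so the Jacobi sum identities are free of
  signs.\<close>

lemma quadratic_form_descent:
  fixes p :: int and Q :: "int \<Rightarrow> int \<Rightarrow> int"
  assumes p: "prime p"
    and hom: "\<And>x y. Q (p * x) (p * y) = p\<^sup>2 * Q x y"
    and dvd: "\<And>x y. p dvd Q x y \<Longrightarrow> p dvd x \<and> p dvd y"
    and eq: "Q x y = p ^ r"
  shows "\<exists>s x' y'. r = 2 * s \<and> x = p ^ s * x' \<and> y = p ^ s * y' \<and> Q x' y' = 1"
  using eq
proof (induction r arbitrary: x y rule: less_induct)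
  case (less r)
  have p0: "p \<noteq> 0" "\<not> p dvd 1" using p by auto
  show ?case
  proof (cases "r = 0")
    case True
    then show ?thesis using less.prems by (intro exI[of _ 0] exI[of _ x] exI[of _ y]) auto
  next
    case False
    then obtain r1 where r1: "r = Suc r1" using not0_implies_Suc by blast
    have "p dvd Q x y" using less.prems r1 by simp
    then obtain x1 y1 where xy: "x = p * x1" "y = p * y1" using dvd by (meson dvdE)
    have "p * (p * Q x1 y1) = p * p ^ r1"
      using less.prems hom[of x1 y1] xy r1 by (simp add: power2_eq_square)
    then have Q1: "p * Q x1 y1 = p ^ r1" using p0 by simp
    \<comment> \<open>An odd exponent would end in p * Q = 1 and make p a unit, so each round of the
      descent removes exactly two factors p.\<close>
    have "r1 \<noteq> 0" using Q1 p0 by (metis dvd_triv_left power_0)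
    then obtain r2 where r2: "r1 = Suc r2" using not0_implies_Suc by blast
    have "Q x1 y1 = p ^ r2" using Q1 r2 p0 by simp
    from less.IH[OF _ this] r1 r2 obtain s x' y' where
      "r2 = 2 * s" "x1 = p ^ s * x'" "y1 = p ^ s * y'" "Q x' y' = 1" by auto
    then show ?thesis using xy r1 r2
      by (intro exI[of _ "Suc s"] exI[of _ x'] exI[of _ y']) auto
  qed
qed

lemma fermat_little_int:
  fixes p x :: int
  assumes "prime p" "\<not> p dvd x"
  shows "[x ^ (nat p - 1) = 1] (mod p)"
proof -
  have p1: "p > 1" using assms(1) by (rule prime_gt_1_int)
  have pp: "prime (nat p)" using assms(1) p1 by (simp add: prime_nat_iff_prime)
  have "coprime p x" using assms by (rule prime_imp_coprime)
  then have "coprime x p" by (simp add: coprime_commute)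
  moreover have "residues p" using p1 by (simp add: residues_def)
  ultimately show ?thesis
    using residues.euler_theorem[of p x] totient_prime[OF pp] by simp
qed

text \<open>Cubing is injective on units modulo p = 3m + 2, since Fermat's theorem reads z^(3m) * z
  = 1. The form divides x^3 - y^3, so x = y modulo p and the form collapses to 3 y^2.\<close>

lemma prime_dvd_eisenstein_form:
  fixes p x y :: int
  assumes p: "prime p" "p mod 3 = 2" and dvd: "p dvd x\<^sup>2 + x * y + y\<^sup>2"
  shows "p dvd x \<and> p dvd y"
proof (rule ccontr)
  assume neg: "\<not> (p dvd x \<and> p dvd y)"
  have nd: "\<not> p dvd x" "\<not> p dvd y"
  proof -
    have "p dvd x \<Longrightarrow> p dvd y * y"
    proof -
      assume "p dvd x"
      then have "p dvd x\<^sup>2 + x * y" by (simp add: power2_eq_square)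
      then show "p dvd y * y" using dvd
        by (metis dvd_add_right_iff power2_eq_square)
    qed
    moreover have "p dvd y \<Longrightarrow> p dvd x * x"
    proof -
      assume "p dvd y"
      then have "p dvd x * y + y\<^sup>2" by (simp add: power2_eq_square)
      then show "p dvd x * x" using dvd
        by (metis add.assoc dvd_add_left_iff power2_eq_square)
    qed
    ultimately show "\<not> p dvd x" "\<not> p dvd y" using neg p(1) prime_dvd_mult_iff by blast+
  qed
  define m where "m = nat (p div 3)"
  have pm: "nat p - 1 = 3 * m + 1"
  proof -
    have "p = 3 * (p div 3) + 2" using p(2) by presburger
    moreover have "p div 3 \<ge> 0" using prime_gt_1_int[OF p(1)] by (simp add: pos_imp_zdiv_nonneg_iff)
    ultimately have "p = 3 * int m + 2" by (simp add: m_def)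
    then show ?thesis by simp
  qed
  have "x ^ 3 - y ^ 3 = (x - y) * (x\<^sup>2 + x * y + y\<^sup>2)"
    by (simp add: algebra_simps power2_eq_square power3_eq_cube)
  then have "[x ^ 3 = y ^ 3] (mod p)" using dvd by (simp add: cong_iff_dvd_diff)
  then have "[(x ^ 3) ^ m * x = (y ^ 3) ^ m * x] (mod p)" 
    by (metis cong_pow cong_scalar_right)
  moreover have "[(x ^ 3) ^ m * x = 1] (mod p)" "[(y ^ 3) ^ m * y = 1] (mod p)"
    using fermat_little_int[OF p(1) nd(1)] fermat_little_int[OF p(1) nd(2)]
    unfolding pm by (simp_all only: power_mult power_add power_one_right)
  ultimately have "[(y ^ 3) ^ m * x = (y ^ 3) ^ m * y] (mod p)"
    by (meson cong_sym cong_trans)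
  moreover have "coprime ((y ^ 3) ^ m) p"
    using nd p(1) by (metis coprime_commute coprime_power_left_iff prime_imp_coprime)
  ultimately have xy: "[x = y] (mod p)" using cong_mult_lcancel by blast
  have "[x\<^sup>2 + x * y + y\<^sup>2 = y\<^sup>2 + y * y + y\<^sup>2] (mod p)"
    using xy by (intro cong_add cong_mult cong_pow cong_refl)
  then have "p dvd 3 * y\<^sup>2" using dvd
    by (simp add: cong_dvd_iff power2_eq_square)
  then have "p dvd 3" using nd p(1) by (simp add: prime_dvd_mult_iff prime_dvd_power_iff)
  then have "p \<le> 3" by (simp add: zdvd_imp_le)
  then have "p = 2" using p prime_gt_1_int[OF p(1)]
    by (smt (verit) mod_self)
  then show False using \<open>p dvd 3\<close> by simp
qed

text \<open>For p = 4m + 3 the exponent (p - 1)/2 is odd. Raising x^2 = -y^2 to it turns both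
  squares into 1 by Fermat's theorem and leaves 1 = -1 modulo p.\<close>

lemma prime_dvd_sum_squares:
  fixes p x y :: int
  assumes p: "prime p" "p mod 4 = 3" and dvd: "p dvd x\<^sup>2 + y\<^sup>2"
  shows "p dvd x \<and> p dvd y"
proof (rule ccontr)
  assume neg: "\<not> (p dvd x \<and> p dvd y)"
  have nd: "\<not> p dvd x" "\<not> p dvd y"
    using neg dvd p(1)
    by (metis dvd_add_right_iff dvd_add_left_iff prime_dvd_power_iff zero_less_numeral)+
  define m where "m = nat (p div 4)"
  have pm: "nat p - 1 = 2 * (2 * m + 1)"
  proof -
    have "p = 4 * (p div 4) + 3" using p(2) by presburger
    moreover have "p div 4 \<ge> 0" using prime_gt_1_int[OF p(1)] by (simp add: pos_imp_zdiv_nonneg_iff)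
    ultimately have "p = 4 * int m + 3" by (simp add: m_def)
    then show ?thesis by simp
  qed
  have "[x\<^sup>2 = - (y\<^sup>2)] (mod p)" using dvd by (simp add: cong_iff_dvd_diff)
  then have "[(x\<^sup>2) ^ (2 * m + 1) = (- (y\<^sup>2)) ^ (2 * m + 1)] (mod p)" by (rule cong_pow)
  moreover have "(- (y\<^sup>2)) ^ (2 * m + 1) = - ((y\<^sup>2) ^ (2 * m + 1))" by simp
  moreover have "[(x\<^sup>2) ^ (2 * m + 1) = 1] (mod p)" "[(y\<^sup>2) ^ (2 * m + 1) = 1] (mod p)"
    using fermat_little_int[OF p(1) nd(1)] fermat_little_int[OF p(1) nd(2)]
    unfolding pm by (simp_all only: power_mult)
  ultimately have "[1 = - 1] (mod p)"
    by (metis cong_minus_minus_iff cong_sym cong_trans)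
  then have "p dvd 2" by (simp add: cong_iff_dvd_diff)
  then have "p \<le> 2" by (simp add: zdvd_imp_le)
  then show False using p prime_gt_1_int[OF p(1)] by (smt (verit) mod_less mod_pos_pos_trivial)
qed

lemma prime_power_dvd_mult:
  fixes p a b :: int
  assumes "prime p" "p ^ r dvd a * b" "\<not> (p dvd a \<and> p dvd b)"
  shows "p ^ r dvd a \<or> p ^ r dvd b"
proof -
  have "coprime (p ^ r) a \<or> coprime (p ^ r) b"
    using assms(1,3) by (metis coprime_power_left_iff prime_imp_coprime)
  then show ?thesis using assms(2) by (metis coprime_dvd_mult_left_iff coprime_dvd_mult_right_iff)
qed

text \<open>The product (c d' - c' d)(c d' + c' d) is a multiple of q, and p cannot divide both
  factors, so q divides one of them outright. Composing the two representations shows that this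
  factor is zero: otherwise the resulting representation of (A q)^2 would be too large, as D >
  A^2.\<close>

lemma quadratic_representation_unique:
  fixes p A D c d c' d' :: int
  assumes p: "prime p" "odd p" and q: "q = p ^ r"
    and eq: "A * q = c\<^sup>2 + D * d\<^sup>2" "A * q = c'\<^sup>2 + D * d'\<^sup>2"
    and nd: "\<not> p dvd c" "\<not> p dvd c'"
    and AD: "A \<noteq> 0" "A\<^sup>2 < D" and r: "r > 0"
  shows "c\<^sup>2 = c'\<^sup>2"
proof -
  have q0: "q > 0" using p(1) q prime_gt_0_int by simp
  have pq: "p dvd q" using q r by (simp add: dvd_power)
  have prod: "(c * d' - c' * d) * (c * d' + c' * d) = q * (A * (d'\<^sup>2 - d\<^sup>2))"
  proof -
    have "c\<^sup>2 = A * q - D * d\<^sup>2" "c'\<^sup>2 = A * q - D * d'\<^sup>2" using eq by auto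
    then have "c\<^sup>2 * d'\<^sup>2 - c'\<^sup>2 * d\<^sup>2 = (A * q - D * d\<^sup>2) * d'\<^sup>2 - (A * q - D * d'\<^sup>2) * d\<^sup>2" by simp
    then show ?thesis by (simp add: algebra_simps power2_eq_square)
  qed
  have not_both: "\<not> (p dvd c * d' - c' * d \<and> p dvd c * d' + c' * d)"
  proof
    assume "p dvd c * d' - c' * d \<and> p dvd c * d' + c' * d"
    then have "p dvd (c * d' - c' * d) + (c * d' + c' * d)" using dvd_add by blast
    then have "p dvd 2 * (c * d')" by (simp add: algebra_simps)
    moreover have "\<not> p dvd 2" using p by (metis primes_dvd_imp_eq two_is_prime dvd_refl)
    ultimately have "p dvd d'" using p(1) nd by (metis prime_dvd_mult_iff)
    then have "p dvd A * q - D * d'\<^sup>2" using pq by (simp add: power2_eq_square)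
    then have "p dvd c'\<^sup>2" using eq(2) by simp
    then show False using nd p(1) prime_dvd_power by blast
  qed
  \<comment> \<open>\<open>e\<close> stands for \<open>d\<close> or \<open>- d\<close>, so that one
    argument serves both factors.\<close>
  have zero: "c * d' - c' * e = 0" if dv: "q dvd c * d' - c' * e" and ed: "e\<^sup>2 = d\<^sup>2" for e
  proof (rule ccontr)
    assume ne: "c * d' - c' * e \<noteq> 0"
    obtain t where t: "c * d' - c' * e = q * t" using dv by (rule dvdE)
    then have "t \<noteq> 0" using ne by auto
    then have t1: "t\<^sup>2 \<ge> 1" by (simp add: int_one_le_iff_zero_less)
    \<comment> \<open>Brahmagupta's composition identity; for nonzero t its last term is at least D
      q^2.\<close>
    have "(A * q)\<^sup>2 = (c * c' + D * (e * d'))\<^sup>2 + D * (c * d' - c' * e)\<^sup>2"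
    proof -
      have "(A * q)\<^sup>2 = (c\<^sup>2 + D * e\<^sup>2) * (c'\<^sup>2 + D * d'\<^sup>2)"
        using eq ed by (simp add: power2_eq_square)
      also have "\<dots> = (c * c' + D * (e * d'))\<^sup>2 + D * (c * d' - c' * e)\<^sup>2"
        by (simp add: algebra_simps power2_eq_square)
      finally show ?thesis .
    qed
    then have "A\<^sup>2 * q\<^sup>2 = (c * c' + D * (e * d'))\<^sup>2 + (D * t\<^sup>2) * q\<^sup>2"
      unfolding t by (simp only: power_mult_distrib mult.assoc mult.commute[of "q\<^sup>2"])
    then have "(D * t\<^sup>2) * q\<^sup>2 \<le> A\<^sup>2 * q\<^sup>2" by simp
    then have "A\<^sup>2 \<ge> D * t\<^sup>2" using q0 by (simp only: mult_le_cancel_right) auto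
    moreover have "D * t\<^sup>2 \<ge> D"
      using mult_left_mono[OF t1, of D] AD(2) zero_le_power2[of A] by linarith
    ultimately show False using AD(2) by simp
  qed
  have "q dvd c * d' - c' * d \<or> q dvd c * d' + c' * d"
    using prime_power_dvd_mult[OF p(1) _ not_both] prod q by simp
  then have "(c * d' - c' * d) * (c * d' + c' * d) = 0"
    using zero[of d] zero[of "- d"] by auto
  then have "d'\<^sup>2 = d\<^sup>2" using prod q0 AD(1) by auto
  then show ?thesis using eq by simp
qed

section \<open>Valuations of factorials and binomial coefficients\<close>

lemma multiplicity_fact_add_less:
  fixes p m s :: nat
  assumes p: "prime p" and s: "s < p"
  shows "multiplicity p (fact (p * m + s) :: nat) = multiplicity p (fact (p * m) :: nat)"
  using s
proof (induction s)
  case (Suc s)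
  have "\<not> p dvd Suc (p * m + s)"
  proof
    assume "p dvd Suc (p * m + s)"
    then have "p dvd p * m + Suc s" by simp
    then have "p dvd Suc s" by (simp only: dvd_add_right_iff dvd_triv_left)
    then show False using Suc.prems by (auto dest: dvd_imp_le)
  qed
  then have "multiplicity p (Suc (p * m + s)) = 0" by (rule not_dvd_imp_multiplicity_0)
  moreover have "multiplicity p (Suc (p * m + s) * fact (p * m + s)) =
      multiplicity p (Suc (p * m + s)) + multiplicity p (fact (p * m + s) :: nat)"
    using p by (intro prime_elem_multiplicity_mult_distrib) auto
  ultimately show ?case using Suc by (simp del: mult_Suc)
qed simp

lemma multiplicity_fact_mult:
  fixes p m :: nat
  assumes p: "prime p"
  shows "multiplicity p (fact (p * m) :: nat) = m + multiplicity p (fact m :: nat)"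
proof (induction m)
  case (Suc m)
  have p0: "p > 0" using p prime_gt_0_nat by blast
  have e: "p * Suc m = Suc (p * m + (p - 1))" using p0 by simp
  have "multiplicity p (fact (p * Suc m) :: nat) =
      multiplicity p ((p * Suc m) * fact (p * m + (p - 1)) :: nat)"
    by (simp only: e fact_Suc of_nat_id)
  also have "\<dots> = multiplicity p (p * Suc m) + multiplicity p (fact (p * m + (p - 1)) :: nat)"
    using p p0 by (intro prime_elem_multiplicity_mult_distrib) auto
  also have "multiplicity p (p * Suc m) = Suc (multiplicity p (Suc m))"
    using p p0 by (intro multiplicity_times_same) (auto dest: not_prime_unit)
  also have "multiplicity p (fact (p * m + (p - 1)) :: nat) = m + multiplicity p (fact m :: nat)"
    using multiplicity_fact_add_less[OF p, of "p - 1" m] Suc p0 by simp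
  finally show ?case
    using prime_elem_multiplicity_mult_distrib[of p "Suc m" "fact m :: nat"] p by simp
qed simp

text \<open>All base-p digits of n = (p^r - 1)/k equal a = (p - 1)/k. For j <= k the digits j a of j
  n are still below p, so multiplication by j causes no carry and the valuation of the factorial is
  additive. The induction strips the last digit: n = p n' + a.\<close>

lemma multiplicity_fact_mult_digit:
  fixes p k a r n :: nat
  assumes p: "prime p" "p = k * a + 1" and n: "p ^ r = k * n + 1"
  shows "\<forall>j\<le>k. multiplicity p (fact (j * n) :: nat) = j * multiplicity p (fact n :: nat)"
proof -
  have k: "k > 0"
  proof (rule ccontr)
    assume "\<not> k > 0"
    then have "p = 1" using p(2) by simp
    then show False using p(1) by simp
  qed
  show ?thesis using n
  proof (induction r arbitrary: n)
    case 0
    then show ?case using k by auto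
  next
    case (Suc r)
    have "[k * a + 1 = 0 + 1] (mod k)" by (intro cong_add cong_refl) (simp add: cong_0_iff)
    then have "[p ^ r = 1 ^ r] (mod k)" using p(2) by (intro cong_pow) simp
    then have "k dvd p ^ r - 1"
      using p(1) by (subst (asm) cong_altdef_nat) (simp_all add: prime_gt_0_nat Suc_leI)
    then obtain n' where "p ^ r - 1 = k * n'" by auto
    then have n': "p ^ r = k * n' + 1" using p(1)
      by (metis Suc_pred' add.commute plus_1_eq_Suc prime_gt_0_nat zero_less_power)
    have "k * n + 1 = p * (k * n' + 1)" using Suc.prems n' by simp
    also have "\<dots> = k * (p * n' + a) + 1" using p(2) by (simp add: algebra_simps)
    finally have n: "n = p * n' + a" using k by simp
    have step: "multiplicity p (fact (i * n) :: nat) = i * (n' + multiplicity p (fact n' :: nat))"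
      if "i \<le> k" for i
    proof -
      have "i * a \<le> k * a" using that by simp
      then have "i * a < p" using p(2) by linarith
      moreover have "i * n = p * (i * n') + i * a" using n by (simp add: algebra_simps)
      ultimately show ?thesis
        using multiplicity_fact_add_less[OF p(1), of "i * a" "i * n'"]
          multiplicity_fact_mult[OF p(1), of "i * n'"] Suc.IH[OF n'] that
        by (simp add: algebra_simps)
    qed
    show ?case using step step[of 1] k by (simp add: algebra_simps)
  qed
qed

text \<open>Kummer's theorem counts the carries in adding \<open>n\<close> and \<open>j * n\<close>
  in base p, and there are none. Here this appears as the valuation of n! taken (j + 1) - j - 1 = 0
  times.\<close>

lemma prime_not_dvd_binomial_digit:
  fixes p k a r n j :: nat
  assumes p: "prime p" "p = k * a + 1" and n: "p ^ r = k * n + 1" and j: "Suc j \<le> k"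
  shows "\<not> p dvd (Suc j * n choose n)"
proof
  assume dvd: "p dvd (Suc j * n choose n)"
  have "multiplicity p (fact (j * n) * fact n * (Suc j * n choose n) :: nat)
      = multiplicity p (fact (Suc j * n) :: nat)"
    using binomial_fact_lemma[of n "Suc j * n"] by (simp add: mult.commute)
  moreover have "multiplicity p (fact (j * n) * fact n * (Suc j * n choose n) :: nat) =
      multiplicity p (fact (j * n) :: nat) + multiplicity p (fact n :: nat) +
      multiplicity p (Suc j * n choose n)"
    using p(1) by (simp add: prime_elem_multiplicity_mult_distrib del: mult_Suc)
  ultimately have "multiplicity p (Suc j * n choose n) = 0"
    using multiplicity_fact_mult_digit[OF p n, rule_format, of j]
      multiplicity_fact_mult_digit[OF p n, rule_format, of "Suc j"] j by (simp only: mult_Suc) simp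
  moreover have "multiplicity p (Suc j * n choose n) > 0"
    using dvd p(1) by (subst prime_multiplicity_gt_zero_iff) (auto simp del: mult_Suc)
  ultimately show False by simp
qed

section \<open>Identifying the normalised representation\<close>

lemma square_eq_imp_eq_int:
  fixes x y m :: int
  assumes "x\<^sup>2 = y\<^sup>2" "[x = 1] (mod m)" "[y = 1] (mod m)" "m > 2"
  shows "x = y"
proof (rule ccontr)
  assume "x \<noteq> y"
  then have "x = - y" using assms(1) by (simp add: power2_eq_iff)
  then have "[- 1 = y] (mod m)"
    using assms(2) by (metis cong_minus_minus_iff cong_sym minus_minus)
  then have "[- 1 = 1] (mod m)" using assms(3) cong_trans by blast
  then have "m dvd 2" by (simp add: cong_iff_dvd_diff)
  then show False using assms(4) by (auto dest: zdvd_imp_le)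
qed

text \<open>Multiplying the norm form by 4 completes the square, 4 q = (2 a - b)^2 + 3 b^2, and
  \<open>3 dvd b\<close> turns the last term into 27 d^2. If p is inert, descent strips all factors
  p and leaves an Eisenstein unit. The congruence modulo 3 fixes the sign in both cases.\<close>

lemma cubic_representation_determined:
  fixes p q r :: nat and a b c :: int
  assumes p: "prime p" "\<not> 3 dvd p" and q: "q = p ^ r" "r > 0"
    and ab: "int q = a\<^sup>2 - a * b + b\<^sup>2" "3 dvd b" "[2 * a - b = 1] (mod 3)"
    and nd: "[p = 1] (mod 3) \<Longrightarrow> \<not> int p dvd 2 * a - b"
    and c1: "[p = 1] (mod 3) \<Longrightarrow>
      (\<exists>d::int. 4 * int q = c\<^sup>2 + 27 * d\<^sup>2) \<and> [c = 1] (mod 3) \<and> \<not> int p dvd c"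
    and c2: "[p = 2] (mod 3) \<Longrightarrow> c = - 2 * (- int p) ^ (r div 2)"
  shows "c = 2 * a - b"
proof -
  have pp: "prime (int p)" using p(1) by simp
  have "p mod 3 = 1 \<or> p mod 3 = 2" using p(2) by presburger
  then consider "[p = 1] (mod 3)" | "[p = 2] (mod 3)" by (auto simp: cong_def)
  then show ?thesis
  proof cases
    case 1
    obtain d where d: "4 * int q = c\<^sup>2 + 27 * d\<^sup>2" using c1 1 by blast
    obtain d0 where d0: "b = 3 * d0" using ab(2) by (rule dvdE)
    have "4 * int q = (2 * a - b)\<^sup>2 + 3 * b\<^sup>2"
      unfolding ab(1) by (simp add: algebra_simps power2_eq_square)
    then have e: "4 * int q = (2 * a - b)\<^sup>2 + 27 * d0\<^sup>2" by (simp add: d0)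
    have "p \<noteq> 2" using 1 by (auto simp: cong_def)
    then have "odd (int p)" using p(1) by (metis even_of_nat primes_dvd_imp_eq two_is_prime_nat)
    then have "c\<^sup>2 = (2 * a - b)\<^sup>2"
      using q(1) c1[OF 1] nd[OF 1] q(2)
      by (intro quadratic_representation_unique[OF pp _ _ d e, of r]) auto
    then show ?thesis using square_eq_imp_eq_int[of c "2 * a - b" 3] c1[OF 1] ab(3) by simp
  next
    case 2
    have pm: "int p mod 3 = 2" using 2 unfolding cong_def by presburger
    \<comment> \<open>The sign of b is flipped to match the form x^2 + x y + y^2 of
      \<open>prime_dvd_eisenstein_form\<close>.\<close>
    have "\<exists>s x' y'. r = 2 * s \<and> a = int p ^ s * x' \<and> - b = int p ^ s * y' \<and>
        x'\<^sup>2 + x' * y' + y'\<^sup>2 = 1"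
    proof (rule quadratic_form_descent[OF pp])
      show "a\<^sup>2 + a * - b + (- b)\<^sup>2 = int p ^ r" using ab(1) q(1) by simp
      show "int p dvd u\<^sup>2 + u * v + v\<^sup>2 \<Longrightarrow> int p dvd u \<and> int p dvd v" for u v
        by (rule prime_dvd_eisenstein_form[OF pp pm])
    qed (simp add: algebra_simps power2_eq_square)
    then obtain s x y where s: "r = 2 * s" "a = int p ^ s * x" "- b = int p ^ s * y"
      and xy: "x\<^sup>2 + x * y + y\<^sup>2 = 1" by blast
    have "3 dvd int p ^ s * y" using ab(2) s(3) by (metis dvd_minus_iff)
    moreover have "\<not> 3 dvd int p ^ s"
      using prime_dvd_power[of "3::int" "int p" s] pm by auto
    moreover have "prime (3::int)" by simp
    ultimately have "3 dvd y" using prime_dvd_mult_iff by blast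
    then obtain z where z: "y = 3 * z" by (rule dvdE)
    \<comment> \<open>Of the six units only 1 and -1 have second coordinate divisible by 3, because
      27 z^2 <= 4 forces z = 0.\<close>
    have "(2 * x + y)\<^sup>2 + 3 * y\<^sup>2 = 4 * (x\<^sup>2 + x * y + y\<^sup>2)"
      by (simp add: algebra_simps power2_eq_square)
    then have "(2 * x + y)\<^sup>2 + 27 * z\<^sup>2 = 4" using xy z by simp
    then have "27 * z\<^sup>2 \<le> 4" using zero_le_power2[of "2 * x + y"] by linarith
    then have "z\<^sup>2 < 1" by simp
    then have y0: "y = 0" using z by (metis int_one_le_iff_zero_less mult_zero_right not_le zero_less_power2)
    then have x1: "x\<^sup>2 = 1" using xy by simp
    have c: "c = - 2 * (- int p) ^ s" using c2[OF 2] s(1) by simp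
    have "c\<^sup>2 = 4 * (int p ^ s)\<^sup>2"
      unfolding c by (simp add: power_mult_distrib power_even_eq[symmetric] flip: power_mult)
    also have "\<dots> = (2 * a - b)\<^sup>2" using s y0 x1 by (simp add: power_mult_distrib)
    finally have "c\<^sup>2 = (2 * a - b)\<^sup>2" .
    moreover have "[c = 1] (mod 3)"
    proof -
      \<comment> \<open>As -p = 1 modulo 3, the base -p rather than p gives c the residue -2 = 1 for
        every s.\<close>
      have "[- int p = 1] (mod 3)" using pm unfolding cong_def by presburger
      then have "[- 2 * (- int p) ^ s = - 2 * 1 ^ s] (mod 3)" by (intro cong_mult cong_pow cong_refl)
      moreover have "[- 2 * 1 ^ s = 1] (mod (3::int))" by (simp add: cong_def)
      ultimately show ?thesis unfolding c by (rule cong_trans)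
    qed
    ultimately show ?thesis using square_eq_imp_eq_int[of c "2 * a - b" 3] ab(3) by simp
  qed
qed

text \<open>In the inert case both representations descend to Gaussian units. The even second
  coordinate excludes i and -i, so both first entries have square p^r and only the sign
  remains.\<close>

lemma quartic_representation_determined:
  fixes p q r :: nat and a b e f :: int
  assumes p: "prime p" "odd p" and q: "q = p ^ r" "r > 0"
    and ab: "int q = a\<^sup>2 + 4 * b\<^sup>2" "[a = 1] (mod 4)"
    and ef: "int q = e\<^sup>2 + 4 * f\<^sup>2" "[e = 1] (mod 4)"
    and nd: "[p = 1] (mod 4) \<Longrightarrow> \<not> int p dvd a"
    and nd': "[p = 1] (mod 4) \<Longrightarrow> \<not> int p dvd e"
  shows "e = a"
proof -
  have pp: "prime (int p)" using p(1) by simp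
  have "p mod 4 = 1 \<or> p mod 4 = 3" using p(2) by presburger
  then consider "[p = 1] (mod 4)" | "p mod 4 = 3" by (auto simp: cong_def)
  then have "e\<^sup>2 = a\<^sup>2"
  proof cases
    case 1
    show ?thesis
      using q p(2) nd[OF 1] nd'[OF 1] ef(1) ab(1)
      by (intro quadratic_representation_unique[OF pp, of "int q" r 1 e 4 f a b]) auto
  next
    case 2
    have pm: "int p mod 4 = 3" using 2 by presburger
    have *: "\<exists>s. r = 2 * s \<and> x\<^sup>2 = (int p ^ s)\<^sup>2" if xy: "int q = x\<^sup>2 + 4 * y\<^sup>2" for x y
    proof -
      have "\<exists>s x' y'. r = 2 * s \<and> x = int p ^ s * x' \<and> 2 * y = int p ^ s * y' \<and>
          x'\<^sup>2 + y'\<^sup>2 = 1"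
      proof (rule quadratic_form_descent[OF pp])
        show "x\<^sup>2 + (2 * y)\<^sup>2 = int p ^ r" using xy q(1) by simp
        show "int p dvd u\<^sup>2 + v\<^sup>2 \<Longrightarrow> int p dvd u \<and> int p dvd v" for u v
          by (rule prime_dvd_sum_squares[OF pp pm])
      qed (simp add: algebra_simps power2_eq_square)
      then obtain s x' y' where s: "r = 2 * s" "x = int p ^ s * x'" "2 * y = int p ^ s * y'"
        and xy: "x'\<^sup>2 + y'\<^sup>2 = 1" by blast
      have "odd (int p ^ s)" using p(2) by simp
      then have "even y'" using s(3) by (metis dvd_triv_left even_mult_iff)
      then obtain z where "y' = 2 * z" by (rule dvdE)
      then have e: "x'\<^sup>2 + 4 * z\<^sup>2 = 1" using xy by simp
      then have "z\<^sup>2 < 1" using zero_le_power2[of x'] by linarith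
      then have "z = 0" by (metis int_one_le_iff_zero_less not_le zero_less_power2)
      then have "x'\<^sup>2 = 1" using e by simp
      then show ?thesis using s by (auto simp: power_mult_distrib)
    qed
    show ?thesis using *[OF ab(1)] *[OF ef(1)] by auto
  qed
  then show ?thesis using square_eq_imp_eq_int[of e a 4] ab(2) ef(2) by simp
qed

section \<open>Characters and Jacobi sums over a finite field\<close>

locale finite_field = field R for R (structure) +
  assumes finite_carrier [simp, intro]: "finite (carrier R)"
begin

lemma inv_closed [simp]: "x \<in> carrier R \<Longrightarrow> x \<noteq> \<zero> \<Longrightarrow> inv x \<in> carrier R"
  and inv_right [simp]: "x \<in> carrier R \<Longrightarrow> x \<noteq> \<zero> \<Longrightarrow> x \<otimes> inv x = \<one>"
  and inv_left [simp]: "x \<in> carrier R \<Longrightarrow> x \<noteq> \<zero> \<Longrightarrow> inv x \<otimes> x = \<one>"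
  by (auto simp: field_Units)

lemma inv_nonzero [simp]: "x \<in> carrier R \<Longrightarrow> x \<noteq> \<zero> \<Longrightarrow> inv x \<noteq> \<zero>"
  by (metis inv_right r_null zero_not_one)

lemma one_minus_one_minus [simp]: "x \<in> carrier R \<Longrightarrow> \<one> \<ominus> (\<one> \<ominus> x) = x"
  by algebra

lemma bij_one_minus: "bij_betw (\<lambda>x. \<one> \<ominus> x) (carrier R) (carrier R)"
  by (rule bij_betwI[where g = "\<lambda>x. \<one> \<ominus> x"]) auto

lemma bij_mult:
  assumes "a \<in> carrier R" "a \<noteq> \<zero>"
  shows "bij_betw (\<lambda>x. a \<otimes> x) (carrier R) (carrier R)"
  using assms
  by (intro bij_betwI[where g = "\<lambda>x. inv a \<otimes> x"]) (auto simp flip: m_assoc)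

lemma bij_mult_nonzero:
  assumes "a \<in> carrier R" "a \<noteq> \<zero>"
  shows "bij_betw (\<lambda>x. a \<otimes> x) (carrier R - {\<zero>}) (carrier R - {\<zero>})"
  using assms
  by (intro bij_betwI[where g = "\<lambda>x. inv a \<otimes> x"]) (auto simp: integral_iff simp flip: m_assoc)

lemma inv_inv [simp]: "x \<in> carrier R \<Longrightarrow> x \<noteq> \<zero> \<Longrightarrow> inv (inv x) = x"
  by (simp add: field_Units)

lemma mult_inv_cancel [simp]:
  "x \<in> carrier R \<Longrightarrow> u \<in> carrier R \<Longrightarrow> u \<noteq> \<zero> \<Longrightarrow> x \<otimes> inv u \<otimes> u = x"
  by (simp add: m_assoc)

lemma nat_pow_nonzero: "x \<in> carrier R \<Longrightarrow> x \<noteq> \<zero> \<Longrightarrow> x [^] (n::nat) \<noteq> \<zero>"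
  by (induction n) (auto simp: integral_iff)

lemma one_minus_one [simp]: "\<one> \<ominus> \<one> = \<zero>"
  by simp

lemma one_minus_nonzero [simp]:
  "x \<in> carrier R \<Longrightarrow> x \<noteq> \<one> \<Longrightarrow> \<one> \<ominus> x \<noteq> \<zero>"
  using r_right_minus_eq[of \<one> x] by auto

lemma bij_inv: "bij_betw (\<lambda>x. inv x) (carrier R - {\<zero>}) (carrier R - {\<zero>})"
  by (rule bij_betwI[where g = "\<lambda>x. inv x"]) auto

lemma bij_betw_card_eqI:
  assumes "inj_on f A" "f ` A \<subseteq> B" "finite B" "card B \<le> card A"
  shows "bij_betw f A B"
  using assms by (metis bij_betw_def card_image card_seteq)

lemma card_minus_two:
  assumes "a \<in> carrier R" "b \<in> carrier R" "a \<noteq> b"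
  shows "card (carrier R - {a, b}) = order R - 2"
  using assms by (simp add: order_def card_Diff_subset)

text \<open>On the projective line x/(1 - x) sends 1 to infinity and infinity to -1, hence the two
  deleted points. Injectivity suffices because the cardinalities agree.\<close>

lemma bij_quotient_one_minus:
  "bij_betw (\<lambda>x. x \<otimes> inv (\<one> \<ominus> x)) (carrier R - {\<one>}) (carrier R - {\<ominus> \<one>})"
proof (rule bij_betw_card_eqI)
  let ?f = "\<lambda>x. x \<otimes> inv (\<one> \<ominus> x)"
  have f: "?f x \<otimes> (\<one> \<ominus> x) = x" if "x \<in> carrier R" "x \<noteq> \<one>" for x
    using that by simp
  show "inj_on ?f (carrier R - {\<one>})"
  proof (rule inj_onI)
    fix x y
    assume "x \<in> carrier R - {\<one>}" "y \<in> carrier R - {\<one>}" and e: "?f x = ?f y"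
    then have xy: "x \<in> carrier R" "x \<noteq> \<one>" "y \<in> carrier R" "y \<noteq> \<one>" by auto
    define u where "u = ?f y"
    have u: "u \<in> carrier R" using xy by (simp add: u_def)
    have "x = u \<otimes> (\<one> \<ominus> x)" "y = u \<otimes> (\<one> \<ominus> y)" using f xy e u_def by metis+
    then have "x \<ominus> y = u \<otimes> (\<one> \<ominus> x) \<ominus> u \<otimes> (\<one> \<ominus> y)" by simp
    also have "\<dots> = \<ominus> (u \<otimes> (x \<ominus> y))" using u xy(1,3) by algebra
    finally have "x \<ominus> y = \<ominus> (u \<otimes> (x \<ominus> y))" .
    then have "(x \<ominus> y) \<oplus> u \<otimes> (x \<ominus> y) = \<ominus> (u \<otimes> (x \<ominus> y)) \<oplus> u \<otimes> (x \<ominus> y)" by simp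
    also have "\<dots> = \<zero>" using u xy(1,3) by (intro l_neg) simp
    also have "(x \<ominus> y) \<oplus> u \<otimes> (x \<ominus> y) = (\<one> \<oplus> u) \<otimes> (x \<ominus> y)" using u xy(1,3) by algebra
    finally have "(\<one> \<oplus> u) \<otimes> (x \<ominus> y) = \<zero>" .
    \<comment> \<open>In fact 1 + u is the inverse of 1 - y.\<close>
    moreover have "\<one> \<oplus> u \<noteq> \<zero>"
    proof
      assume "\<one> \<oplus> u = \<zero>"
      have "\<one> = (\<one> \<ominus> y) \<oplus> u \<otimes> (\<one> \<ominus> y)"
        using \<open>y = u \<otimes> (\<one> \<ominus> y)\<close> u xy(3) by algebra
      also have "\<dots> = (\<one> \<oplus> u) \<otimes> (\<one> \<ominus> y)" using u xy(3) by algebra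
      finally show False using \<open>\<one> \<oplus> u = \<zero>\<close> xy(3) by simp
    qed
    ultimately show "x = y" using u xy by (simp add: integral_iff)
  qed
  show "?f ` (carrier R - {\<one>}) \<subseteq> carrier R - {\<ominus> \<one>}"
  proof (rule image_subsetI)
    fix x assume "x \<in> carrier R - {\<one>}"
    then have x: "x \<in> carrier R" "x \<noteq> \<one>" by auto
    have "?f x \<noteq> \<ominus> \<one>"
    proof
      assume e: "?f x = \<ominus> \<one>"
      have "x = \<ominus> \<one> \<otimes> (\<one> \<ominus> x)" using f[OF x] e by simp
      also have "\<dots> = x \<ominus> \<one>" using x(1) by algebra
      finally have "\<one> \<ominus> x \<oplus> x = \<one> \<ominus> x \<oplus> (x \<ominus> \<one>)" by simp
      then have "\<one> = \<zero>" using x(1) by algebra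
      then show False by simp
    qed
    then show "?f x \<in> carrier R - {\<ominus> \<one>}" using x by simp
  qed
qed (simp_all add: card_Diff_subset)

text \<open>
  The linear fractional transformation below sends \<open>1, 0, \<infinity>\<close> to \<open>\<infinity>, 1, t\<close>, which explains the two
  values missing from its image.
\<close>

lemma bij_linear_fractional:
  assumes t: "t \<in> carrier R" "t \<noteq> \<one>"
  shows "bij_betw (\<lambda>y. (\<one> \<ominus> t \<otimes> y) \<otimes> inv (\<one> \<ominus> y)) (carrier R - {\<zero>, \<one>}) (carrier R - {\<one>, t})"
proof (rule bij_betw_card_eqI)
  let ?f = "\<lambda>y. (\<one> \<ominus> t \<otimes> y) \<otimes> inv (\<one> \<ominus> y)"
  have f: "?f y \<otimes> (\<one> \<ominus> y) = \<one> \<ominus> t \<otimes> y" if "y \<in> carrier R - {\<zero>, \<one>}" for y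
    using that t(1) by (intro mult_inv_cancel one_minus_nonzero) auto
  have t0: "\<one> \<ominus> t \<in> carrier R" "\<one> \<ominus> t \<noteq> \<zero>" using t by auto
  show "inj_on ?f (carrier R - {\<zero>, \<one>})"
  proof (rule inj_onI)
    fix x y
    assume xy: "x \<in> carrier R - {\<zero>, \<one>}" "y \<in> carrier R - {\<zero>, \<one>}" and e: "?f x = ?f y"
    have fc: "?f y \<in> carrier R" using xy t by auto
    have cl: "x \<in> carrier R" "y \<in> carrier R" using xy by auto
    \<comment> \<open>The factor 1 - t is the determinant of the transformation, which splits off
      from the cross difference of two values.\<close>
    have "(\<one> \<ominus> t) \<otimes> (x \<ominus> y) = (\<one> \<ominus> t \<otimes> x) \<otimes> (\<one> \<ominus> y) \<ominus> (\<one> \<ominus> t \<otimes> y) \<otimes> (\<one> \<ominus> x)"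
      using cl t(1) by algebra
    also have "\<dots> = ?f x \<otimes> (\<one> \<ominus> x) \<otimes> (\<one> \<ominus> y) \<ominus> ?f y \<otimes> (\<one> \<ominus> y) \<otimes> (\<one> \<ominus> x)"
      unfolding f[OF xy(1)] f[OF xy(2)] ..
    also have "\<dots> = \<zero>"
      unfolding e using cl fc by (simp add: m_assoc m_comm[of "\<one> \<ominus> x"])
    finally show "x = y" using t0 xy by (simp add: integral_iff)
  qed
  show "?f ` (carrier R - {\<zero>, \<one>}) \<subseteq> carrier R - {\<one>, t}"
  proof (rule image_subsetI)
    fix y assume y: "y \<in> carrier R - {\<zero>, \<one>}"
    then have cl: "y \<in> carrier R" by simp
    have fc: "?f y \<in> carrier R" using y t by auto
    have "?f y \<noteq> \<one>"
    proof
      assume "?f y = \<one>"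
      then have "\<one> \<ominus> t \<otimes> y \<ominus> (\<one> \<ominus> y) = \<zero>" using f[OF y] y t by simp
      moreover have "\<one> \<ominus> t \<otimes> y \<ominus> (\<one> \<ominus> y) = (\<one> \<ominus> t) \<otimes> y" using cl t(1) by algebra
      ultimately show False using t0 y by (simp add: integral_iff)
    qed
    moreover have "?f y \<noteq> t"
    proof
      assume "?f y = t"
      then have "\<one> \<ominus> t \<otimes> y \<ominus> t \<otimes> (\<one> \<ominus> y) = \<zero>" using f[OF y] y t by simp
      moreover have "\<one> \<ominus> t \<otimes> y \<ominus> t \<otimes> (\<one> \<ominus> y) = \<one> \<ominus> t" using cl t(1) by algebra
      ultimately show False using t0 by simp
    qed
    ultimately show "?f y \<in> carrier R - {\<one>, t}" using fc by simp
  qed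
qed (use t in \<open>simp_all add: card_minus_two\<close>)

end

section \<open>Power residue characters and their Jacobi sums\<close>

locale power_residue_character = finite_field R for R (structure) +
  fixes \<chi> :: "'a \<Rightarrow> complex" and k :: nat
  assumes char_zero [simp]: "\<chi> \<zero> = 0"
    and char_mult: "\<And>x y. x \<in> carrier R \<Longrightarrow> y \<in> carrier R \<Longrightarrow> \<chi> (x \<otimes> y) = \<chi> x * \<chi> y"
    and char_power: "\<And>x. x \<in> carrier R \<Longrightarrow> x \<noteq> \<zero> \<Longrightarrow> \<chi> x ^ k = 1"
    and char_eq_1_iff: "\<And>x. x \<in> carrier R \<Longrightarrow> \<chi> x = 1 \<longleftrightarrow> x \<in> unit_powers R k"
    and char_primitive: "\<exists>g\<in>carrier R - {\<zero>}. \<forall>i. 0 < i \<longrightarrow> i < k \<longrightarrow> \<chi> g ^ i \<noteq> 1"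
    and char_minus_one [simp]: "\<chi> (\<ominus> \<one>) = 1"
    and two_le: "2 \<le> k"
begin

text \<open>
  The power \<open>\<chi> x ^ 0\<close> is \<open>1\<close> also at \<open>x = \<zero>\<close>; this is the source of the summand \<open>2 * k\<close> in
  \<open>num_consecutive_jacobi\<close>.
\<close>

definition jacobi :: "nat \<Rightarrow> nat \<Rightarrow> complex" where
  "jacobi i j = (\<Sum>x\<in>carrier R. \<chi> x ^ i * \<chi> (\<one> \<ominus> x) ^ j)"

lemma char_one [simp]: "\<chi> \<one> = 1"
  using char_mult[of "\<ominus> \<one>" "\<ominus> \<one>"] by (simp add: l_minus)

lemma char_nonzero: "x \<in> carrier R \<Longrightarrow> x \<noteq> \<zero> \<Longrightarrow> \<chi> x \<noteq> 0"
  using char_power[of x] two_le by (auto simp: power_0_left)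

lemma char_inv: "x \<in> carrier R \<Longrightarrow> x \<noteq> \<zero> \<Longrightarrow> \<chi> (inv x) = inverse (\<chi> x)"
  using char_mult[of x "inv x"] by (metis inv_closed inv_right char_one inverse_unique)

lemma char_uminus: "x \<in> carrier R \<Longrightarrow> \<chi> (\<ominus> x) = \<chi> x"
  using char_mult[of "\<ominus> \<one>" x] by (simp add: l_minus)

lemma norm_char: "x \<in> carrier R \<Longrightarrow> x \<noteq> \<zero> \<Longrightarrow> norm (\<chi> x) = 1"
proof -
  assume "x \<in> carrier R" "x \<noteq> \<zero>"
  then have "norm (\<chi> x) ^ k = 1" using char_power[of x] by (metis norm_one norm_power)
  then show "norm (\<chi> x) = 1" using two_le power_eq_imp_eq_base[of "norm (\<chi> x)" k 1] by simp
qed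

lemma cnj_char:
  assumes "x \<in> carrier R" "x \<noteq> \<zero>"
  shows "cnj (\<chi> x) = inverse (\<chi> x)"
  using complex_mult_cnj[of "\<chi> x"] norm_char[OF assms] complex_norm_square[of "\<chi> x"]
  by (metis inverse_unique of_real_1 power_one)

text \<open>Both strict bounds on i matter at x = 0: there the two sides are zero only if neither
  exponent is 0.\<close>

lemma cnj_char_power:
  assumes "x \<in> carrier R" "i < k" "i > 0"
  shows "cnj (\<chi> x ^ i) = \<chi> x ^ (k - i)"
proof (cases "x = \<zero>")
  case False
  then have "\<chi> x ^ i * \<chi> x ^ (k - i) = 1"
    using char_power[OF assms(1)] assms(2) by (simp flip: power_add)
  then show ?thesis using False assms(1)
    by (simp add: cnj_char power_inverse inverse_unique)
qed (use assms in \<open>simp add: power_0_left\<close>)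

text \<open>The sum is invariant under x -> g x, which multiplies it by chi(g)^i, a value different
  from 1.\<close>

lemma sum_char_power:
  assumes "0 < i" "i < k"
  shows "(\<Sum>x\<in>carrier R. \<chi> x ^ i) = 0"
proof -
  obtain g where g: "g \<in> carrier R" "g \<noteq> \<zero>" "\<chi> g ^ i \<noteq> 1" using char_primitive assms by auto
  have "(\<Sum>x\<in>carrier R. \<chi> x ^ i) = (\<Sum>x\<in>carrier R. \<chi> (g \<otimes> x) ^ i)"
    by (rule sum.reindex_bij_betw[OF bij_mult[OF g(1,2)], symmetric])
  also have "\<dots> = \<chi> g ^ i * (\<Sum>x\<in>carrier R. \<chi> x ^ i)"
    using g by (simp add: char_mult power_mult_distrib sum_distrib_left)
  finally show ?thesis using g(3) by simp
qed

lemma jacobi_commute: "jacobi i j = jacobi j i"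
  unfolding jacobi_def
  by (subst sum.reindex_bij_betw[OF bij_one_minus, symmetric]) (auto intro!: sum.cong)

lemma jacobi_0_0: "jacobi 0 0 = of_nat (order R)"
  by (simp add: jacobi_def order_def)

lemma jacobi_0_left:
  assumes "0 < j" "j < k"
  shows "jacobi 0 j = 0"
  using sum_char_power[OF assms] sum.reindex_bij_betw[OF bij_one_minus, of "\<lambda>x. \<chi> x ^ j"]
  by (simp add: jacobi_def)

lemma jacobi_0_right:
  assumes "0 < i" "i < k"
  shows "jacobi i 0 = 0"
  using jacobi_0_left[OF assms] jacobi_commute by simp

text \<open>The summand is chi^i at x/(1 - x), a quotient that takes every value except -1. The full
  character sum vanishes, so what remains is -chi(-1)^i = -1.\<close>

lemma jacobi_inverse:
  assumes "0 < i" "i < k"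
  shows "jacobi i (k - i) = - 1"
proof -
  have "jacobi i (k - i) = (\<Sum>x\<in>carrier R - {\<one>}. \<chi> x ^ i * \<chi> (\<one> \<ominus> x) ^ (k - i))"
    unfolding jacobi_def using assms by (intro sum.mono_neutral_right) auto
  also have "\<dots> = (\<Sum>x\<in>carrier R - {\<one>}. \<chi> (x \<otimes> inv (\<one> \<ominus> x)) ^ i)"
  proof (rule sum.cong[OF refl])
    fix x assume "x \<in> carrier R - {\<one>}"
    then have x: "x \<in> carrier R" "\<one> \<ominus> x \<in> carrier R" "\<one> \<ominus> x \<noteq> \<zero>" by auto
    have "\<chi> (\<one> \<ominus> x) ^ (k - i) = inverse (\<chi> (\<one> \<ominus> x)) ^ i"
      using cnj_char_power[OF x(2) assms(2,1)] cnj_char[OF x(2,3)] by simp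
    then show "\<chi> x ^ i * \<chi> (\<one> \<ominus> x) ^ (k - i) = \<chi> (x \<otimes> inv (\<one> \<ominus> x)) ^ i"
      using x by (simp add: char_mult char_inv power_mult_distrib)
  qed
  also have "\<dots> = (\<Sum>x\<in>carrier R - {\<ominus> \<one>}. \<chi> x ^ i)"
    by (rule sum.reindex_bij_betw[OF bij_quotient_one_minus])
  also have "\<dots> = (\<Sum>x\<in>carrier R. \<chi> x ^ i) - 1"
    by (subst sum_diff1) auto
  finally show ?thesis using sum_char_power[OF assms] by simp
qed

lemma jacobi_cnj:
  assumes "0 < i" "i < k" "0 < j" "j < k"
  shows "jacobi (k - i) (k - j) = cnj (jacobi i j)"
  unfolding jacobi_def cnj_sum complex_cnj_mult using assms
  by (intro sum.cong) (simp_all only: cnj_char_power minus_closed one_closed)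

text \<open>Substituting 1/x turns chi(x) chi(1 - x) into chi^(-2)(x) chi(1 - x), and chi^(-2) =
  chi^2 for a character of order four.\<close>

lemma jacobi_reflect:
  assumes "k = 4"
  shows "jacobi 1 2 = jacobi 1 1"
proof -
  have "jacobi 1 1 = (\<Sum>x\<in>carrier R - {\<zero>}. \<chi> x * \<chi> (\<one> \<ominus> x))"
    unfolding jacobi_def by (intro sum.mono_neutral_cong_right) auto
  also have "\<dots> = (\<Sum>x\<in>carrier R - {\<zero>}. \<chi> (inv x) * \<chi> (\<one> \<ominus> inv x))"
    by (rule sum.reindex_bij_betw[OF bij_inv, symmetric])
  also have "\<dots> = (\<Sum>x\<in>carrier R - {\<zero>}. \<chi> x ^ 2 * \<chi> (\<one> \<ominus> x))"
  proof (rule sum.cong[OF refl])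
    fix x assume "x \<in> carrier R - {\<zero>}"
    then have x: "x \<in> carrier R" "x \<noteq> \<zero>" by auto
    have "inv x \<otimes> \<ominus> (\<one> \<ominus> x) = inv x \<otimes> x \<ominus> inv x" using x(1) inv_closed[OF x] by algebra
    then have "\<one> \<ominus> inv x = inv x \<otimes> \<ominus> (\<one> \<ominus> x)" using x by simp
    then have "\<chi> (\<one> \<ominus> inv x) = inverse (\<chi> x) * \<chi> (\<one> \<ominus> x)"
      using x by (simp add: char_mult char_inv char_uminus)
    moreover have "inverse (\<chi> x) * inverse (\<chi> x) = \<chi> x ^ 2"
      using cnj_char_power[OF x(1), of 2] assms cnj_char[OF x] by (simp add: power2_eq_square)
    ultimately show "\<chi> (inv x) * \<chi> (\<one> \<ominus> inv x) = \<chi> x ^ 2 * \<chi> (\<one> \<ominus> x)"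
      using x by (simp add: char_inv flip: mult.assoc)
  qed
  also have "\<dots> = jacobi 2 1"
    unfolding jacobi_def by (intro sum.mono_neutral_cong_left) auto
  finally show ?thesis by (simp add: jacobi_commute)
qed

text \<open>
  Substituting \<open>x = y \<otimes> t\<close> in the first factor turns the product into a double sum whose sum over
  \<open>y\<close>, for fixed \<open>t\<close>, runs over the values of a linear fractional transformation.
\<close>

lemma jacobi_mult_cnj:
  assumes "2 < k"
  shows "jacobi 1 1 * cnj (jacobi 1 1) = of_nat (order R)"
proof -
  let ?F = "carrier R" and ?D = "carrier R - {\<zero>, \<one>}" and ?U = "carrier R - {\<zero>}"
  define J where "J = jacobi 1 1"
  have J: "J = (\<Sum>x\<in>carrier R. \<chi> x * \<chi> (\<one> \<ominus> x))" by (simp add: J_def jacobi_def)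
  have J': "J = (\<Sum>t\<in>?U. \<chi> (y \<otimes> t) * \<chi> (\<one> \<ominus> y \<otimes> t))" if "y \<in> ?D" for y
  proof -
    have "J = (\<Sum>x\<in>?U. \<chi> x * \<chi> (\<one> \<ominus> x))"
      unfolding J by (intro sum.mono_neutral_cong_right) auto
    also have "\<dots> = (\<Sum>t\<in>?U. \<chi> (y \<otimes> t) * \<chi> (\<one> \<ominus> y \<otimes> t))"
      using that by (intro sum.reindex_bij_betw[OF bij_mult_nonzero, symmetric]) auto
    finally show ?thesis .
  qed
  have "cnj J = (\<Sum>y\<in>?D. cnj (\<chi> y * \<chi> (\<one> \<ominus> y)))"
    unfolding J cnj_sum by (intro sum.mono_neutral_cong_right) auto
  then have "J * cnj J = (\<Sum>y\<in>?D. cnj (\<chi> y * \<chi> (\<one> \<ominus> y)) * J)"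
    by (simp add: sum_distrib_left mult.commute)
  also have "\<dots> = (\<Sum>y\<in>?D. \<Sum>t\<in>?U. cnj (\<chi> y * \<chi> (\<one> \<ominus> y)) * (\<chi> (y \<otimes> t) * \<chi> (\<one> \<ominus> y \<otimes> t)))"
    by (intro sum.cong refl, subst J', assumption) (simp add: sum_distrib_left)
  also have "\<dots> = (\<Sum>y\<in>?D. \<Sum>t\<in>?U. \<chi> t * \<chi> ((\<one> \<ominus> t \<otimes> y) \<otimes> inv (\<one> \<ominus> y)))"
  proof (intro sum.cong refl)
    fix y t assume "y \<in> ?D" "t \<in> ?U"
    then have yt: "y \<in> ?F" "y \<noteq> \<zero>" "y \<noteq> \<one>" "t \<in> ?F" by auto
    have "cnj (\<chi> y) * \<chi> y = 1" using yt by (simp add: cnj_char char_nonzero)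
    then show "cnj (\<chi> y * \<chi> (\<one> \<ominus> y)) * (\<chi> (y \<otimes> t) * \<chi> (\<one> \<ominus> y \<otimes> t)) =
        \<chi> t * \<chi> ((\<one> \<ominus> t \<otimes> y) \<otimes> inv (\<one> \<ominus> y))"
      using yt by (simp add: char_mult char_inv cnj_char char_nonzero m_comm[of y t])
  qed
  also have "\<dots> = (\<Sum>t\<in>?U. \<chi> t * (\<Sum>y\<in>?D. \<chi> ((\<one> \<ominus> t \<otimes> y) \<otimes> inv (\<one> \<ominus> y))))"
    by (subst sum.swap) (simp add: sum_distrib_left)
  \<comment> \<open>For t = 1 the transformation is constantly 1 on its q - 2 arguments. Otherwise
    it misses exactly 1 and t, so the vanishing character sum leaves -1 - chi(t).\<close>
  also have "\<dots> = (\<Sum>t\<in>?U. \<chi> t * (if t = \<one> then of_nat (order R) - 2 else - 1 - \<chi> t))"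
  proof (intro sum.cong refl arg_cong2[where f = "(*)"])
    fix t assume t: "t \<in> ?U"
    show "(\<Sum>y\<in>?D. \<chi> ((\<one> \<ominus> t \<otimes> y) \<otimes> inv (\<one> \<ominus> y))) =
        (if t = \<one> then of_nat (order R) - 2 else - 1 - \<chi> t)"
    proof (cases "t = \<one>")
      case True
      have "(\<Sum>y\<in>?D. \<chi> ((\<one> \<ominus> t \<otimes> y) \<otimes> inv (\<one> \<ominus> y))) = (\<Sum>y\<in>?D. 1)"
        using True by (intro sum.cong) auto
      also have "\<dots> = of_nat (order R - 2)" by (simp add: card_minus_two del: card_Diff_insert)
      also have "\<dots> = of_nat (order R) - 2"
        using card_mono[of ?F "{\<zero>, \<one>}"] by (simp add: order_def of_nat_diff)
      finally show ?thesis using True by simp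
    next
      case False
      have "(\<Sum>y\<in>?D. \<chi> ((\<one> \<ominus> t \<otimes> y) \<otimes> inv (\<one> \<ominus> y))) = (\<Sum>y\<in>?F - {\<one>, t}. \<chi> y)"
        using t False by (intro sum.reindex_bij_betw[OF bij_linear_fractional]) auto
      also have "\<dots> = (\<Sum>y\<in>?F. \<chi> y) - (\<Sum>y\<in>{\<one>, t}. \<chi> y)"
        using t by (intro sum_diff) auto
      also have "\<dots> = - 1 - \<chi> t"
        using sum_char_power[of 1] two_le False by simp
      finally show ?thesis using False by simp
    qed
  qed
  also have "\<dots> = (of_nat (order R) - 2) + (\<Sum>t\<in>?D. \<chi> t * (- 1 - \<chi> t))"
  proof -
    have "?U - {\<one>} = ?D" by auto
    then show ?thesis by (subst sum.remove[of _ \<one>]) (auto intro!: sum.cong)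
  qed
  also have "(\<Sum>t\<in>?D. \<chi> t * (- 1 - \<chi> t)) = (\<Sum>t\<in>?F - {\<one>}. \<chi> t * (- 1 - \<chi> t))"
    by (intro sum.mono_neutral_left) auto
  also have "\<dots> = (\<Sum>t\<in>?F. \<chi> t * (- 1 - \<chi> t)) + 2"
    by (subst sum_diff1) auto
  also have "(\<Sum>t\<in>?F. \<chi> t * (- 1 - \<chi> t)) = - (\<Sum>t\<in>?F. \<chi> t ^ 1) - (\<Sum>t\<in>?F. \<chi> t ^ 2)"
    by (simp add: algebra_simps power2_eq_square sum_subtractf sum_negf)
  \<comment> \<open>Here 2 < k enters: for k = 2 the square of chi is trivial and its sum is q -
    1.\<close>
  also have "\<dots> = 0" using sum_char_power[of 1] sum_char_power[of 2] assms by simp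
  finally show ?thesis by (simp add: J_def)
qed

section \<open>Cyclotomic numbers in terms of Jacobi sums\<close>

definition num_consecutive :: nat where
  "num_consecutive = card {x \<in> unit_powers R k. \<one> \<ominus> x \<in> unit_powers R k}"

lemma zero_notin_unit_powers [simp]: "\<zero> \<notin> unit_powers R k"
  using char_eq_1_iff[of \<zero>] by simp

lemma one_in_unit_powers [simp]: "\<one> \<in> unit_powers R k"
  using char_eq_1_iff[of \<one>] by simp

lemma unit_powers_closed: "unit_powers R k \<subseteq> carrier R"
  by (auto simp: unit_powers_def)

lemma sum_powers_char:
  assumes "x \<in> carrier R"
  shows "(\<Sum>i<k. \<chi> x ^ i) =
    (if x = \<zero> then 1 else if x \<in> unit_powers R k then of_nat k else 0)"
proof -
  consider "x = \<zero>" | "x \<noteq> \<zero>" "\<chi> x = 1" | "x \<noteq> \<zero>" "\<chi> x \<noteq> 1" by blast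
  then show ?thesis
  proof cases
    case 1
    then show ?thesis using two_le by (simp add: power_0_left sum.delta)
  next
    case 2
    have "(\<Sum>i<k. \<chi> x ^ i) = of_nat k" unfolding 2(2) by simp
    then show ?thesis using 2 char_eq_1_iff[OF assms] by simp
  next
    case 3
    then show ?thesis using assms char_eq_1_iff char_power[of x] by (simp add: sum_gp_strict)
  qed
qed

lemma num_consecutive_jacobi:
  "of_nat (k\<^sup>2 * num_consecutive + 2 * k) = (\<Sum>i<k. \<Sum>j<k. jacobi i j)"
proof -
  let ?F = "carrier R" and ?U = "unit_powers R k"
  let ?T = "\<lambda>x. \<Sum>i<k. \<chi> x ^ i"
  let ?A = "{x \<in> ?U. \<one> \<ominus> x \<in> ?U}"
  have A: "?A \<subseteq> ?F - {\<zero>, \<one>}" using unit_powers_closed by auto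
  have "(\<Sum>i<k. \<Sum>j<k. jacobi i j) = (\<Sum>i<k. \<Sum>x\<in>?F. \<chi> x ^ i * ?T (\<one> \<ominus> x))"
    unfolding jacobi_def by (intro sum.cong refl, subst sum.swap) (simp add: sum_distrib_left)
  also have "\<dots> = (\<Sum>x\<in>?F. ?T x * ?T (\<one> \<ominus> x))"
    by (subst sum.swap) (simp add: sum_distrib_right)
  \<comment> \<open>At x = 0 and at x = 1 one factor is the value 1 of the expansion at zero and the
    other is k.\<close>
  also have "\<dots> = ?T \<zero> * ?T \<one> + (\<Sum>x\<in>?F - {\<zero>}. ?T x * ?T (\<one> \<ominus> x))"
    by (subst sum.remove[of _ \<zero>]) (auto simp: a_minus_def)
  also have "(\<Sum>x\<in>?F - {\<zero>}. ?T x * ?T (\<one> \<ominus> x)) =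
      ?T \<one> * ?T \<zero> + (\<Sum>x\<in>?F - {\<zero>, \<one>}. ?T x * ?T (\<one> \<ominus> x))"
    by (subst sum.remove[of _ \<one>]) (auto intro!: sum.cong)
  also have "(\<Sum>x\<in>?F - {\<zero>, \<one>}. ?T x * ?T (\<one> \<ominus> x)) =
      (\<Sum>x\<in>?F - {\<zero>, \<one>}. if x \<in> ?A then of_nat (k\<^sup>2) else 0)"
    by (intro sum.cong refl) (auto simp: sum_powers_char power2_eq_square)
  also have "\<dots> = of_nat (k\<^sup>2 * num_consecutive)"
    unfolding sum.inter_restrict[symmetric, OF finite_Diff[OF finite_carrier]] Int_absorb1[OF A]
    by (simp add: num_consecutive_def)
  finally have "(\<Sum>i<k. \<Sum>j<k. jacobi i j) =
    ?T \<zero> * ?T \<one> + (?T \<one> * ?T \<zero> + of_nat (k\<^sup>2 * num_consecutive))" .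
  moreover have "?T \<zero> = 1" using sum_powers_char[OF zero_closed] by (simp only: refl if_True)
  moreover have "?T \<one> = of_nat k" using sum_powers_char[OF one_closed]
    by (simp only: one_in_unit_powers if_True one_not_zero if_False)
  ultimately show ?thesis by (simp only: of_nat_add of_nat_mult of_nat_numeral) simp
qed

text \<open>For k = 2 every Jacobi sum is degenerate: J(0,0) = q and J(1,1) = -1, so with the
  correction 2 k = 4 no quadratic form enters.\<close>

lemma num_consecutive_quadratic:
  assumes "k = 2"
  shows "4 * int num_consecutive = int (order R) - 5"
proof -
  have "of_nat (k\<^sup>2 * num_consecutive + 2 * k) = complex_of_int (int (order R) - 1)"
    using jacobi_0_0 jacobi_0_left[of 1] jacobi_0_right[of 1] jacobi_inverse[of 1] assms
    unfolding num_consecutive_jacobi by (simp add: eval_nat_numeral)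
  then have "complex_of_int (4 * int num_consecutive + 4) = complex_of_int (int (order R) - 1)"
    using assms by simp
  then show ?thesis by (simp only: of_int_eq_iff)
qed

text \<open>J(1,2) and J(2,1) contribute -2, the correction 2 k contributes -6, and J(2,2) is the
  conjugate of J(1,1).\<close>

lemma num_consecutive_cubic_jacobi:
  assumes "k = 3"
  shows "9 * real num_consecutive = real (order R) - 8 + 2 * Re (jacobi 1 1)"
proof -
  have "of_nat (k\<^sup>2 * num_consecutive + 2 * k) = of_nat (order R) - 2 + (jacobi 1 1 + cnj (jacobi 1 1))"
    using jacobi_0_0 jacobi_0_left[of 1] jacobi_0_right[of 1] jacobi_0_left[of 2] jacobi_0_right[of 2]
      jacobi_inverse[of 1] jacobi_inverse[of 2] jacobi_cnj[of 1 1] assms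
    unfolding num_consecutive_jacobi by (simp add: eval_nat_numeral)
  then have "Re (of_nat (k\<^sup>2 * num_consecutive + 2 * k)) =
      Re (of_nat (order R) - 2 + (jacobi 1 1 + cnj (jacobi 1 1)))"
    by simp
  then show ?thesis using assms by simp
qed

text \<open>The three inverse pairs contribute -3 and the correction 2 k contributes -8. Reflection
  and conjugation make the other six nontrivial sums three copies each of J(1,1) and its
  conjugate.\<close>

lemma num_consecutive_quartic_jacobi:
  assumes "k = 4"
  shows "16 * real num_consecutive = real (order R) - 11 + 6 * Re (jacobi 1 1)"
proof -
  have J: "jacobi 1 2 = jacobi 1 1" "jacobi 2 1 = jacobi 1 1"
    using jacobi_reflect[OF assms] jacobi_commute by metis+
  have "jacobi 3 3 = cnj (jacobi 1 1)" "jacobi 3 2 = cnj (jacobi 1 1)" "jacobi 2 3 = cnj (jacobi 1 1)"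
    using jacobi_cnj[of 1 1] jacobi_cnj[of 1 2] jacobi_cnj[of 2 1] J assms by simp_all
  then have "of_nat (k\<^sup>2 * num_consecutive + 2 * k) =
      of_nat (order R) - 3 + 3 * (jacobi 1 1 + cnj (jacobi 1 1))"
    using jacobi_0_0 jacobi_0_left[of 1] jacobi_0_right[of 1] jacobi_0_left[of 2] jacobi_0_right[of 2]
      jacobi_0_left[of 3] jacobi_0_right[of 3]
      jacobi_inverse[of 1] jacobi_inverse[of 2] jacobi_inverse[of 3] J assms
    unfolding num_consecutive_jacobi by (simp add: eval_nat_numeral)
  then have "Re (of_nat (k\<^sup>2 * num_consecutive + 2 * k)) =
      Re (of_nat (order R) - 3 + 3 * (jacobi 1 1 + cnj (jacobi 1 1)))"
    by simp
  then show ?thesis using assms by simp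
qed

end

section \<open>Construction of the characters\<close>

lemma cis_power_eq_1_iff:
  assumes "k > 0"
  shows "cis (2 * pi / real k) ^ i = 1 \<longleftrightarrow> k dvd i"
proof -
  have e: "cis (2 * pi / real k) ^ i = cis (2 * pi * real i / real k)" for i
    by (simp add: DeMoivre algebra_simps)
  have one: "cis (2 * pi / real k) ^ k = 1" using assms by (simp add: e)
  have "cis (2 * pi / real k) ^ i = cis (2 * pi / real k) ^ (k * (i div k) + i mod k)"
    by simp
  also have "\<dots> = cis (2 * pi / real k) ^ (i mod k)"
    by (simp only: power_add power_mult one power_one mult_1)
  also have "\<dots> = 1 \<longleftrightarrow> i mod k = 0"
  proof
    assume "cis (2 * pi / real k) ^ (i mod k) = 1"
    then have "cis (2 * pi * real (i mod k) / real k) = cis (2 * pi * real 0 / real k)"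
      unfolding e by simp
    then show "i mod k = 0"
      using bij_betw_roots_unity[OF assms] assms unfolding bij_betw_def
      by (meson inj_onD lessThan_iff mod_less_divisor)
  qed simp
  finally show ?thesis by (simp add: dvd_eq_mod_eq_0)
qed

context finite_field
begin

lemma order_gt_1: "order R > 1"
  using card_mono[of "carrier R" "{\<zero>, \<one>}"] by (simp add: order_def)

lemma exists_generator:
  obtains g where "g \<in> carrier R" "g \<noteq> \<zero>"
    "\<And>x. x \<in> carrier R \<Longrightarrow> x \<noteq> \<zero> \<Longrightarrow> \<exists>i::nat. x = g [^] i"
    "\<And>i j :: nat. g [^] i = g [^] j \<longleftrightarrow> [i = j] (mod order R - 1)"
proof -
  obtain g where gc: "g \<in> carrier (mult_of R)"
    and gen: "carrier (mult_of R) = {g [^] i | i::nat. i \<in> UNIV}"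
    using finite_field_mult_group_has_gen[OF finite_carrier] by blast
  have g: "g \<in> carrier R - {\<zero>}" using gc by simp
  interpret G: group "mult_of R" rewrites
      "([^]\<^bsub>mult_of R\<^esub>) = (([^]) :: _ \<Rightarrow> nat \<Rightarrow> _)" and "\<one>\<^bsub>mult_of R\<^esub> = \<one>"
    by (rule field_mult_group) (simp_all add: fun_eq_iff nat_pow_def)
  have fin: "finite (carrier (mult_of R))" by simp
  have "G.ord g = card (carrier (mult_of R))"
  proof -
    have "carrier (mult_of R) = {g [^] i | i. i \<in> {0 .. G.ord g - 1}}"
      unfolding gen using G.ord_elems[OF fin gc] by simp
    also have "\<dots> = (\<lambda>i. g [^] i) ` {0 .. G.ord g - 1}" by blast
    finally have "card (carrier (mult_of R)) \<le> card {0 .. G.ord g - 1}"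
      using card_image_le[of "{0 .. G.ord g - 1}" "\<lambda>i. g [^] i"]
      by (simp only: finite_atLeastAtMost)
    moreover have "G.ord g \<ge> 1" by (rule G.ord_ge_1[OF fin gc])
    moreover have "G.ord g \<le> card (carrier (mult_of R))"
      using G.ord_le_group_order[OF fin gc] by (simp only: order_def)
    ultimately show ?thesis by simp
  qed
  then have ord: "G.ord g = order R - 1" by (simp add: order_def)
  have eq: "g [^] i = g [^] j \<longleftrightarrow> [i = j] (mod order R - 1)" if "j \<le> i" for i j :: nat
  proof -
    have "g [^] i = g [^] j \<longleftrightarrow> g [^] (i - j) = \<one>"
    proof -
      have "g [^] i = g [^] j \<otimes> g [^] (i - j)" using g that by (simp add: nat_pow_mult)
      moreover have "g [^] j \<noteq> \<zero>" using g by (simp add: nat_pow_nonzero)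
      ultimately show ?thesis using g by (metis DiffD1 m_lcancel nat_pow_closed one_closed r_one)
    qed
    also have "\<dots> \<longleftrightarrow> order R - 1 dvd i - j" using G.pow_eq_id[OF gc] ord by simp
    also have "\<dots> \<longleftrightarrow> [i = j] (mod order R - 1)" using that by (simp add: cong_altdef_nat)
    finally show ?thesis .
  qed
  show ?thesis
  proof (rule that)
    show "\<exists>i::nat. x = g [^] i" if "x \<in> carrier R" "x \<noteq> \<zero>" for x
    proof -
      have "x \<in> carrier (mult_of R)" using that by simp
      then show ?thesis unfolding gen by blast
    qed
    show "g [^] i = g [^] j \<longleftrightarrow> [i = j] (mod order R - 1)" for i j :: nat
      using eq[of i j] eq[of j i] by (metis cong_sym_eq nat_le_linear)
  qed (use g in auto)
qed

text \<open>The character sends g^i to zeta^i for a primitive k-th root of unity zeta: it reads off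
  the discrete logarithm modulo k.\<close>

lemma exists_power_residue_character:
  assumes k: "2 \<le> k" and even: "even (order R) \<Longrightarrow> k dvd order R - 1"
    and odd: "odd (order R) \<Longrightarrow> k dvd (order R - 1) div 2"
  obtains \<chi> where "power_residue_character R \<chi> k"
proof -
  define N where "N = order R - 1"
  have kN: "k dvd N" using even odd unfolding N_def
    by (metis dvd_div_mult_self dvd_mult2 odd_Suc_minus_one odd_pos even_Suc dvd_trans
        div_dvd_iff_mult dvd_triv_left even_diff_nat odd_one even_plus_one_iff)
  obtain g where g: "g \<in> carrier R" "g \<noteq> \<zero>"
    and gen: "\<And>x. x \<in> carrier R \<Longrightarrow> x \<noteq> \<zero> \<Longrightarrow> \<exists>i::nat. x = g [^] i"
    and eq: "\<And>i j :: nat. g [^] i = g [^] j \<longleftrightarrow> [i = j] (mod N)"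
    using exists_generator unfolding N_def by blast
  \<comment> \<open>The logarithm is determined only modulo N = q - 1; since k divides N, the power
    of zeta does not depend on the choice.\<close>
  define l where "l x = (SOME i::nat. x = g [^] i)" for x
  have l: "g [^] l x = x" if "x \<in> carrier R" "x \<noteq> \<zero>" for x
    using someI_ex[OF gen[OF that]] by (simp add: l_def)
  have gpow0: "g [^] (i::nat) \<noteq> \<zero>" for i using g by (simp add: nat_pow_nonzero)
  define \<zeta> where "\<zeta> = cis (2 * pi / real k)"
  have \<zeta>_1: "\<zeta> ^ i = 1 \<longleftrightarrow> k dvd i" for i
    using cis_power_eq_1_iff[of k i] k by (simp add: \<zeta>_def)
  have \<zeta>_cong: "\<zeta> ^ i = \<zeta> ^ j" if "[i = j] (mod N)" for i j
  proof -
    have "[i = j] (mod k)" using that kN by (rule cong_dvd_modulus_nat)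
    moreover have "\<zeta> ^ i = \<zeta> ^ (i mod k)" for i
    proof -
      have "\<zeta> ^ (k * (i div k) + i mod k) = \<zeta> ^ (i mod k)"
        by (simp only: power_add \<zeta>_1 mult_1 dvd_triv_left iffD2[OF \<zeta>_1])
      then show ?thesis by simp
    qed
    ultimately show ?thesis by (metis cong_def)
  qed
  define \<chi> where "\<chi> x = (if x = \<zero> then 0 else \<zeta> ^ l x)" for x
  have \<chi>g: "\<chi> (g [^] i) = \<zeta> ^ i" for i :: nat
    using \<zeta>_cong[of "l (g [^] i)" i] l[of "g [^] i"] eq g gpow0 by (simp add: \<chi>_def)
  have unit: "g [^] i \<in> unit_powers R k \<longleftrightarrow> k dvd i" for i :: nat
  proof
    assume "g [^] i \<in> unit_powers R k"
    then obtain y where y: "y \<in> carrier R" "y \<noteq> \<zero>" "g [^] i = y [^] k"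
      by (auto simp: unit_powers_def field_Units)
    have "y [^] k = g [^] (l y * k)" using l[OF y(1,2)] g by (metis nat_pow_pow)
    then have "[i = l y * k] (mod N)" using eq y by metis
    then show "k dvd i" using kN by (meson cong_dvd_iff cong_dvd_modulus_nat dvd_triv_right)
  next
    assume "k dvd i"
    then obtain j where "i = j * k" by (metis dvdE mult.commute)
    then have "g [^] i = (g [^] j) [^] k" using g by (simp add: nat_pow_pow)
    then show "g [^] i \<in> unit_powers R k"
      using g gpow0 by (auto simp: unit_powers_def field_Units intro!: exI[of _ "g [^] j"])
  qed
  have zero: "\<zero> \<notin> unit_powers R k"
  proof
    assume "\<zero> \<in> unit_powers R k"
    then obtain y where "y \<in> carrier R" "y \<noteq> \<zero>" "\<zero> = y [^] k"
      by (auto simp: unit_powers_def field_Units)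
    then show False using nat_pow_nonzero by metis
  qed
  have "power_residue_character R \<chi> k"
  proof unfold_locales
    show "\<chi> (x \<otimes> y) = \<chi> x * \<chi> y" if xy: "x \<in> carrier R" "y \<in> carrier R" for x y
    proof (cases "x = \<zero> \<or> y = \<zero>")
      case False
      then have nz: "x \<noteq> \<zero>" "y \<noteq> \<zero>" by auto
      obtain i :: nat where i: "x = g [^] i" using gen[OF xy(1) nz(1)] by blast
      obtain j :: nat where j: "y = g [^] j" using gen[OF xy(2) nz(2)] by blast
      from i j show ?thesis using g by (simp add: nat_pow_mult \<chi>g power_add)
    qed (use xy in \<open>auto simp: \<chi>_def\<close>)
    show "\<chi> x ^ k = 1" if x: "x \<in> carrier R" "x \<noteq> \<zero>" for x
    proof -
      obtain i :: nat where "x = g [^] i" using gen[OF x] by blast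
      then show ?thesis using \<zeta>_1[of "i * k"] by (simp add: \<chi>g power_mult)
    qed
    show "\<chi> x = 1 \<longleftrightarrow> x \<in> unit_powers R k" if x: "x \<in> carrier R" for x
    proof (cases "x = \<zero>")
      case False
      then obtain i :: nat where "x = g [^] i" using gen[OF x] by blast
      then show ?thesis by (simp add: \<chi>g \<zeta>_1 unit)
    qed (simp add: zero, simp add: \<chi>_def)
    have "\<chi> g = \<zeta>" using \<chi>g[of 1] g by simp
    then show "\<exists>g\<in>carrier R - {\<zero>}. \<forall>i>0. i < k \<longrightarrow> \<chi> g ^ i \<noteq> 1"
      using g by (intro bexI[of _ g]) (auto simp: \<zeta>_1 dest: dvd_imp_le)
    have "\<ominus> \<one> \<noteq> \<zero>" by simp
    then obtain i :: nat where i: "\<ominus> \<one> = g [^] i" using gen[of "\<ominus> \<one>"] by blast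
    have "g [^] (2 * i) = g [^] (0::nat)"
    proof -
      have "g [^] (2 * i) = (\<ominus> \<one>) \<otimes> (\<ominus> \<one>)"
        using g unfolding i by (simp add: mult_2 nat_pow_mult)
      then show ?thesis by (simp add: l_minus)
    qed
    then have N2: "N dvd 2 * i" unfolding eq by (simp add: cong_0_iff)
    \<comment> \<open>The exponent of -1 is a multiple of N if N is odd and of N/2 otherwise. In the
      second case the hypothesis k | (q - 1)/2 is exactly what is required.\<close>
    have "k dvd i"
    proof (cases "even (order R)")
      case True
      then have "odd N" using order_gt_1 by (simp add: N_def)
      then have "N dvd i" using N2 by (metis coprime_dvd_mult_right_iff coprime_right_2_iff_odd)
      then show ?thesis using kN dvd_trans by blast
    next
      case False
      then have "even N" using order_gt_1 by (simp add: N_def)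
      then obtain M where M: "N = 2 * M" by (rule dvdE)
      then have "N div 2 dvd i" using N2 by simp
      then show ?thesis using odd[OF False] N_def dvd_trans by blast
    qed
    then show "\<chi> (\<ominus> \<one>) = 1" unfolding i \<chi>g \<zeta>_1 .
  qed (use k in \<open>auto simp: \<chi>_def\<close>)
  then show ?thesis by (rule that)
qed

end

section \<open>Jacobi sums as Eisenstein and Gaussian integers\<close>

lemma sum_integer_span:
  fixes f :: "'a \<Rightarrow> complex" and w :: complex
  assumes "\<And>x. x \<in> A \<Longrightarrow> \<exists>a b::int. f x = of_int a + of_int b * w"
  shows "\<exists>a b::int. sum f A = of_int a + of_int b * w"
  using assms
proof (induction A rule: infinite_finite_induct)
  case (insert x A)
  obtain a b :: int where "f x = of_int a + of_int b * w" using insert.prems by blast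
  moreover obtain c d :: int where "sum f A = of_int c + of_int d * w"
    using insert by blast
  ultimately have "sum f (insert x A) = of_int (a + c) + of_int (b + d) * w"
    using insert.hyps by (simp add: algebra_simps)
  then show ?case by blast
qed (auto intro!: exI[of _ 0])

definition omega :: complex where "omega = Complex (- 1 / 2) (sqrt 3 / 2)"

lemma cube_root_unity_cases:
  fixes z :: complex
  assumes "z ^ 3 = 1"
  shows "z = 1 \<or> z = omega \<or> z = - 1 - omega"
proof -
  have w: "omega * omega = - 1 - omega"
    by (simp add: omega_def complex_eq_iff)
  have "(z - 1) * ((z - omega) * (z - (- 1 - omega))) = z ^ 3 - 1 + (z - 1) * (- 1 - omega - omega * omega)"
    by (simp add: algebra_simps power3_eq_cube)
  then have "(z - 1) * ((z - omega) * (z - (- 1 - omega))) = 0" using assms w by simp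
  then show ?thesis by (simp only: mult_eq_0_iff right_minus_eq)
qed

lemma fourth_root_unity_cases:
  fixes z :: complex
  assumes "z ^ 4 = 1"
  shows "z = 1 \<or> z = - 1 \<or> z = \<i> \<or> z = - \<i>"
proof -
  have "(z - 1) * ((z + 1) * ((z - \<i>) * (z + \<i>))) = z ^ 4 - 1"
    by (simp add: algebra_simps power4_eq_xxxx)
  then have "(z - 1) * ((z + 1) * ((z - \<i>) * (z + \<i>))) = 0" using assms by simp
  then show ?thesis by (simp only: mult_eq_0_iff right_minus_eq eq_neg_iff_add_eq_0)
qed

context power_residue_character
begin

text \<open>Each nonzero summand is itself a k-th root of unity, so the sum stays in the additive
  span of 1 and w.\<close>

lemma jacobi_integer_span:
  assumes "\<And>z::complex. z ^ k = 1 \<Longrightarrow> \<exists>a b::int. z = of_int a + of_int b * w"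
  shows "\<exists>a b::int. jacobi 1 1 = of_int a + of_int b * w"
  unfolding jacobi_def
proof (rule sum_integer_span)
  fix x assume x: "x \<in> carrier R"
  show "\<exists>a b::int. \<chi> x ^ 1 * \<chi> (\<one> \<ominus> x) ^ 1 = of_int a + of_int b * w"
  proof (cases "x = \<zero> \<or> \<one> \<ominus> x = \<zero>")
    case True
    then have "\<chi> x ^ 1 * \<chi> (\<one> \<ominus> x) ^ 1 = of_int 0 + of_int 0 * w" by auto
    then show ?thesis by blast
  next
    case False
    then have "(\<chi> x ^ 1 * \<chi> (\<one> \<ominus> x) ^ 1) ^ k = 1"
      using x char_power by (simp add: power_mult_distrib del: r_right_minus_eq)
    then show ?thesis by (rule assms)
  qed
qed

text \<open>For J = a + b omega the norm is a^2 - a b + b^2 and twice the real part is 2 a - b. The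
  formula for the count expresses 2 a - b through integers and so yields its residue modulo
  3.\<close>

lemma num_consecutive_cubic:
  assumes k: "k = 3" and q: "[order R = 1] (mod 3)"
  shows "\<exists>a b::int. int (order R) = a\<^sup>2 - a * b + b\<^sup>2 \<and> 3 dvd b \<and> [2 * a - b = 1] (mod 3) \<and>
    9 * int num_consecutive = int (order R) - 8 + (2 * a - b)"
proof -
  have "\<exists>a b::int. z = of_int a + of_int b * omega" if "z ^ k = 1" for z :: complex
  proof -
    have "z = of_int 1 + of_int 0 * omega \<or> z = of_int 0 + of_int 1 * omega \<or>
        z = of_int (- 1) + of_int (- 1) * omega"
      using cube_root_unity_cases[of z] that k by auto
    then show ?thesis by blast
  qed
  then obtain a b :: int where J: "jacobi 1 1 = of_int a + of_int b * omega"
    using jacobi_integer_span by blast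
  have "Re (jacobi 1 1 * cnj (jacobi 1 1)) = real (order R)"
    using jacobi_mult_cnj k by simp
  moreover have "Re (jacobi 1 1 * cnj (jacobi 1 1)) = real_of_int (a\<^sup>2 - a * b + b\<^sup>2)"
    unfolding J omega_def by (simp add: algebra_simps power2_eq_square)
  ultimately have "real_of_int (int (order R)) = real_of_int (a\<^sup>2 - a * b + b\<^sup>2)" by simp
  then have Q: "int (order R) = a\<^sup>2 - a * b + b\<^sup>2" by (simp only: of_int_eq_iff)
  have "real_of_int (9 * int num_consecutive) = real_of_int (int (order R) - 8 + (2 * a - b))"
    using num_consecutive_cubic_jacobi[OF k] unfolding J omega_def by simp
  then have n: "9 * int num_consecutive = int (order R) - 8 + (2 * a - b)"
    by (simp only: of_int_eq_iff)
  obtain s where s: "int (order R) = 3 * s + 1"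
  proof -
    have "int (order R) mod 3 = 1" using q unfolding cong_def by presburger
    then have "int (order R) = 3 * (int (order R) div 3) + 1" by presburger
    then show ?thesis by (rule that)
  qed
  define n where "n = int num_consecutive"
  have c: "2 * a - b = 9 * n - 3 * s + 7" using n s by (simp add: n_def)
  \<comment> \<open>Modulo \<open>9\<close>, the norm equation and the integrality of \<open>num_consecutive\<close> force \<open>3 dvd b\<close>.\<close>
  have "3 * b\<^sup>2 = 4 * (3 * s + 1) - (2 * a - b)\<^sup>2"
    unfolding s[symmetric] Q by (simp add: algebra_simps power2_eq_square)
  also have "\<dots> = 9 * (6 * s - 5 - 9 * n\<^sup>2 - s\<^sup>2 + 6 * n * s - 14 * n)"
    unfolding c by (simp add: algebra_simps power2_eq_square)
  finally have "b\<^sup>2 = 3 * (6 * s - 5 - 9 * n\<^sup>2 - s\<^sup>2 + 6 * n * s - 14 * n)" by simp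
  then have "3 dvd b\<^sup>2" by (metis dvd_triv_left)
  then have "3 dvd b" using prime_dvd_power[of "3::int" b 2] by simp
  moreover have "[2 * a - b = 1] (mod 3)" unfolding c cong_def by presburger
  ultimately show ?thesis using Q n by blast
qed

text \<open>Here e is minus the real part of J. Integrality of the count and q = 1 modulo 8 give its
  residue modulo 4; as it is odd, the imaginary part must be even, which produces 4 f^2.\<close>

lemma num_consecutive_quartic:
  assumes k: "k = 4" and q: "[order R = 1] (mod 8)"
  shows "\<exists>e f::int. int (order R) = e\<^sup>2 + 4 * f\<^sup>2 \<and> [e = 1] (mod 4) \<and>
    16 * int num_consecutive = int (order R) - 11 - 6 * e"
proof -
  have "\<exists>a b::int. z = of_int a + of_int b * \<i>" if "z ^ k = 1" for z :: complex
  proof -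
    have "z = of_int 1 + of_int 0 * \<i> \<or> z = of_int (- 1) + of_int 0 * \<i> \<or>
        z = of_int 0 + of_int 1 * \<i> \<or> z = of_int 0 + of_int (- 1) * \<i>"
      using fourth_root_unity_cases[of z] that k by auto
    then show ?thesis by blast
  qed
  then obtain a b :: int where J: "jacobi 1 1 = of_int a + of_int b * \<i>"
    using jacobi_integer_span by blast
  have "Re (jacobi 1 1 * cnj (jacobi 1 1)) = real (order R)"
    using jacobi_mult_cnj k by simp
  moreover have "Re (jacobi 1 1 * cnj (jacobi 1 1)) = real_of_int (a\<^sup>2 + b\<^sup>2)"
    unfolding J by (simp add: algebra_simps power2_eq_square)
  ultimately have "real_of_int (int (order R)) = real_of_int (a\<^sup>2 + b\<^sup>2)" by simp
  then have Q: "int (order R) = a\<^sup>2 + b\<^sup>2" by (simp only: of_int_eq_iff)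
  have "real_of_int (16 * int num_consecutive) = real_of_int (int (order R) - 11 - 6 * (- a))"
    using num_consecutive_quartic_jacobi[OF k] unfolding J by simp
  then have n: "16 * int num_consecutive = int (order R) - 11 - 6 * (- a)"
    by (simp only: of_int_eq_iff)
  have "int (order R mod 8) = 1" using q by (simp add: cong_def)
  then have q8: "int (order R) mod 8 = 1" by (simp add: zmod_int)
  have "int (order R) = 8 * (int (order R) div 8) + 1" using q8 by presburger
  then obtain s where s: "int (order R) = 8 * s + 1" by blast
  \<comment> \<open>Halving 16 N = 8 s - 10 + 6 a and subtracting 4 a isolates -a.\<close>
  have "- a = 4 * (2 * N - s - a + 1) + 1" if "16 * N = Q - 11 - 6 * (- a)" "Q = 8 * s + 1" for N Q
    using that by presburger
  from this[OF n s] have a: "[- a = 1] (mod 4)" by (metis cong_def mod_mult_self4)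
  then have "odd a" unfolding cong_def by presburger
  then have "odd (a\<^sup>2)" by simp
  moreover have "odd (int (order R))" using q8 by presburger
  ultimately have "even (b\<^sup>2)" unfolding Q by simp
  then have "even b" by simp
  then obtain f where "b = 2 * f" by (rule dvdE)
  then have "int (order R) = (- a)\<^sup>2 + 4 * f\<^sup>2" using Q by simp
  then show ?thesis using a n by blast
qed

end

section \<open>Cyclotomic numbers modulo the characteristic\<close>

context finite_field
begin

section \<open>Power sums with values in the field\<close>

lemma finsum_swap:
  assumes "finite A" "finite B" "\<And>x y. x \<in> A \<Longrightarrow> y \<in> B \<Longrightarrow> f x y \<in> carrier R"
  shows "(\<Oplus>x\<in>A. \<Oplus>y\<in>B. f x y) = (\<Oplus>y\<in>B. \<Oplus>x\<in>A. f x y)"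
  using assms(1,3)
proof (induction A)
  case (insert a A)
  then have "(\<Oplus>x\<in>insert a A. \<Oplus>y\<in>B. f x y) = (\<Oplus>y\<in>B. f a y) \<oplus> (\<Oplus>y\<in>B. \<Oplus>x\<in>A. f x y)"
    by (subst finsum_insert) (auto intro!: finsum_closed)
  also have "\<dots> = (\<Oplus>y\<in>B. f a y \<oplus> (\<Oplus>x\<in>A. f x y))"
    using insert by (intro finsum_addf[symmetric]) (auto intro!: finsum_closed)
  also have "\<dots> = (\<Oplus>y\<in>B. \<Oplus>x\<in>insert a A. f x y)"
    using insert by (intro finsum_cong') (auto intro!: finsum_closed)
  finally show ?case .
qed (simp add: finsum_zero)

lemma finsum_nat_multiple:
  fixes h :: "'c \<Rightarrow> nat"
  assumes "finite A" "w \<in> carrier R"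
  shows "(\<Oplus>i\<in>A. [h i] \<cdot> w) = [sum h A] \<cdot> w"
  using assms(1)
proof (induction A)
  case (insert a A)
  then show ?case using assms(2)
    by (subst finsum_insert) (auto simp: add.nat_pow_mult)
qed simp

lemma finsum_reindex_bij:
  assumes "bij_betw h A B" "\<And>x. x \<in> B \<Longrightarrow> f x \<in> carrier R"
  shows "(\<Oplus>x\<in>A. f (h x)) = (\<Oplus>x\<in>B. f x)"
  using finsum_reindex[of f h A] assms by (auto simp: bij_betw_def)

lemma nat_multiple_order: "[order R] \<cdot> \<one> = \<zero>"
  using add.pow_order_eq_1[of \<one>] by (simp add: order_def)

lemma nonzero_pow_order:
  assumes "x \<in> carrier R" "x \<noteq> \<zero>"
  shows "x [^] (order R - 1) = \<one>"
proof -
  interpret G: group "mult_of R" by (rule field_mult_group)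
  show ?thesis using G.pow_order_eq_1[of x] assms
    by (simp add: order_mult_of nat_pow_mult_of)
qed

text \<open>Orthogonality for x -> x^m: scaling by a generator g multiplies the sum by g^m, which is
  not one.\<close>

lemma power_sum_zero:
  assumes "\<not> order R - 1 dvd m"
  shows "(\<Oplus>x\<in>carrier R. x [^] m) = \<zero>"
proof -
  obtain g where g: "g \<in> carrier R" "g \<noteq> \<zero>"
    and "\<And>x. x \<in> carrier R \<Longrightarrow> x \<noteq> \<zero> \<Longrightarrow> \<exists>i::nat. x = g [^] i"
    and eq: "\<And>i j :: nat. g [^] i = g [^] j \<longleftrightarrow> [i = j] (mod order R - 1)"
    using exists_generator by blast
  have "g [^] m \<noteq> \<one>" using eq[of m 0] assms by (simp add: cong_0_iff)
  define S where "S = (\<Oplus>x\<in>carrier R. x [^] m)"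
  have S: "S \<in> carrier R" unfolding S_def by (intro finsum_closed) auto
  have "S = (\<Oplus>x\<in>carrier R. (g \<otimes> x) [^] m)"
    unfolding S_def by (rule finsum_reindex_bij[OF bij_mult[OF g], symmetric]) simp
  also have "\<dots> = (\<Oplus>x\<in>carrier R. g [^] m \<otimes> x [^] m)"
    using g by (intro finsum_cong') (auto simp: nat_pow_distrib)
  also have "\<dots> = g [^] m \<otimes> S"
    unfolding S_def using g by (intro finsum_rdistr[symmetric]) auto
  finally have "(g [^] m \<ominus> \<one>) \<otimes> S = \<zero>"
    using S g by (simp add: minus_eq l_distr l_minus r_neg)
  moreover have "g [^] m \<ominus> \<one> \<noteq> \<zero>" using \<open>g [^] m \<noteq> \<one>\<close> g by simp
  ultimately show ?thesis using S g unfolding S_def[symmetric] by (metis integral minus_closed nat_pow_closed one_closed)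
qed

text \<open>Each nonzero x contributes one, and m > 0 makes the term at zero vanish; q - 1 is -1 in
  the field.\<close>

lemma power_sum_minus_one:
  assumes "order R - 1 dvd m" "m > 0"
  shows "(\<Oplus>x\<in>carrier R. x [^] m) = \<ominus> \<one>"
proof -
  have one: "x [^] m = \<one>" if "x \<in> carrier R - {\<zero>}" for x
  proof -
    obtain j where "m = (order R - 1) * j" using assms(1) by (rule dvdE)
    then show ?thesis using that nonzero_pow_order[of x] by (simp flip: nat_pow_pow)
  qed
  have F: "carrier R = insert \<zero> (carrier R - {\<zero>})" by auto
  have "(\<Oplus>x\<in>carrier R. x [^] m) = \<zero> [^] m \<oplus> (\<Oplus>x\<in>carrier R - {\<zero>}. x [^] m)"
    by (subst F, subst finsum_insert) auto
  also have "(\<Oplus>x\<in>carrier R - {\<zero>}. x [^] m) = (\<Oplus>x\<in>carrier R - {\<zero>}. \<one>)"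
    using one by (intro finsum_cong') auto
  also have "\<dots> = [(order R - 1)] \<cdot> \<one>"
    by (simp add: add.finprod_const order_def)
  finally have "(\<Oplus>x\<in>carrier R. x [^] m) = [(order R - 1)] \<cdot> \<one>"
    using assms(2) by (simp add: nat_pow_zero)
  moreover have "[(order R - 1)] \<cdot> \<one> \<oplus> \<one> = \<zero>"
  proof -
    have "add_pow R (order R) \<one> = add_pow R (Suc (order R - 1)) \<one>" using order_gt_1 by simp
    then show ?thesis using nat_multiple_order by (simp add: add.nat_pow_Suc)
  qed
  ultimately show ?thesis by (metis add.inv_closed add.nat_pow_closed minus_equality one_closed)
qed

text \<open>
  The recursion \<open>x\<^sup>a (x + 1)\<^sup>b\<^sup>+\<^sup>1 = x\<^sup>a (x + 1)\<^sup>b + x\<^sup>a\<^sup>+\<^sup>1 (x + 1)\<^sup>b\<close> matches Pascal's rule; using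
  \<open>x + 1\<close> rather than \<open>1 - x\<close> avoids alternating signs.
\<close>

lemma beta_sum:
  assumes "a + b < 2 * (order R - 1)"
  shows "(\<Oplus>x\<in>carrier R. x [^] a \<otimes> (x \<oplus> \<one>) [^] b) =
    (if a \<le> order R - 1 then add_pow R (b choose (order R - 1 - a)) (\<ominus> \<one>) else \<zero>)"
  using assms
proof (induction b arbitrary: a)
  case 0
  have e: "(\<Oplus>x\<in>carrier R. x [^] a \<otimes> (x \<oplus> \<one>) [^] (0::nat)) = (\<Oplus>x\<in>carrier R. x [^] a)"
    by (intro finsum_cong') auto
  \<comment> \<open>Below 2(q - 1) only the exponent q - 1 has a nonzero power sum; exponent 0 gives
    q ones, hence zero. The whole sum therefore extracts minus the coefficient of x^(q-1).\<close>
  consider "a = 0" | "a = order R - 1" | "0 < a" "a \<noteq> order R - 1" by linarith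
  then show ?case
  proof cases
    case 1
    have "(\<Oplus>x\<in>carrier R. x [^] a) = \<zero>"
      using nat_multiple_order 1 by (simp add: add.finprod_const order_def)
    then show ?thesis using e 1 order_gt_1 by (simp add: binomial_eq_0)
  next
    case 2
    then show ?thesis using e power_sum_minus_one[of a] order_gt_1 by simp
  next
    case 3
    have "\<not> order R - 1 dvd a"
    proof
      assume "order R - 1 dvd a"
      then obtain j where j: "a = (order R - 1) * j" by (rule dvdE)
      then have "j < 2" using 0 by (metis add_0_right mult.commute mult_less_cancel1)
      then have "j = 0 \<or> j = 1" by linarith
      then show False using j 3 by auto
    qed
    then show ?thesis using e power_sum_zero[of a] 3 by (auto simp: binomial_eq_0)
  qed
next
  case (Suc b)
  let ?N = "order R - 1" and ?w = "\<ominus> \<one>"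
  have "(\<Oplus>x\<in>carrier R. x [^] a \<otimes> (x \<oplus> \<one>) [^] Suc b) =
      (\<Oplus>x\<in>carrier R. x [^] Suc a \<otimes> (x \<oplus> \<one>) [^] b \<oplus> x [^] a \<otimes> (x \<oplus> \<one>) [^] b)"
  proof (intro finsum_cong' refl)
    fix x assume x: "x \<in> carrier R"
    define u v where "u = x [^] a" and "v = (x \<oplus> \<one>) [^] b"
    have uv: "u \<in> carrier R" "v \<in> carrier R" using x by (simp_all add: u_def v_def)
    have "u \<otimes> (v \<otimes> (x \<oplus> \<one>)) = u \<otimes> x \<otimes> v \<oplus> u \<otimes> v" using x uv by algebra
    then show "x [^] a \<otimes> (x \<oplus> \<one>) [^] Suc b =
        x [^] Suc a \<otimes> (x \<oplus> \<one>) [^] b \<oplus> x [^] a \<otimes> (x \<oplus> \<one>) [^] b"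
      by (simp add: u_def v_def)
  qed auto
  also have "\<dots> = (\<Oplus>x\<in>carrier R. x [^] Suc a \<otimes> (x \<oplus> \<one>) [^] b) \<oplus>
      (\<Oplus>x\<in>carrier R. x [^] a \<otimes> (x \<oplus> \<one>) [^] b)"
    by (intro finsum_addf) auto
  also have "\<dots> = (if Suc a \<le> ?N then add_pow R (b choose (?N - Suc a)) ?w else \<zero>) \<oplus>
      (if a \<le> ?N then add_pow R (b choose (?N - a)) ?w else \<zero>)"
    using Suc.IH[of "Suc a"] Suc.IH[of a] Suc.prems by simp
  also have "\<dots> = (if a \<le> ?N then add_pow R (Suc b choose (?N - a)) ?w else \<zero>)"
  proof -
    \<comment> \<open>At \<open>a = ?N\<close> the first summand is zero and both binomials are 1;
      below it Pascal's rule applies.\<close>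
    consider "a > ?N" | "a = ?N" | "a < ?N" by linarith
    then show ?thesis
    proof cases
      case 3
      then have "?N - a = Suc (?N - Suc a)" by simp
      then have "Suc b choose (?N - a) = (b choose (?N - Suc a)) + (b choose (?N - a))" by simp
      then show ?thesis using 3 by (simp add: add.nat_pow_mult del: binomial_Suc_Suc)
    qed auto
  qed
  finally show ?case .
qed

text \<open>The additive order of one divides p^r and is not 1, so it is a multiple of p.\<close>

lemma char_dvd_iff:
  assumes p: "prime p" "order R = p ^ r" and z: "[z] \<cdot> \<one> = \<zero>"
  shows "p dvd (z::nat)"
proof -
  have "add.ord \<one> dvd p ^ r"
    using add.ord_dvd_group_order[of \<one>] p(2) by (simp add: order_def)
  then obtain i where i: "add.ord \<one> = p ^ i" using p(1) by (auto simp: divides_primepow_nat)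
  have "i \<noteq> 0"
  proof
    assume "i = 0"
    then have "[(1::nat)] \<cdot> \<one> = \<zero>" using i add.pow_eq_id[of \<one> 1] by simp
    then show False by simp
  qed
  then have "p dvd add.ord \<one>" using i by simp
  also have "add.ord \<one> dvd z" using z add.pow_eq_id[of \<one> z] by simp
  finally show ?thesis .
qed

section \<open>The count expanded in field-valued characters\<close>

lemma geometric_sum:
  assumes "y \<in> carrier R"
  shows "(y \<ominus> \<one>) \<otimes> (\<Oplus>i\<in>{..<k::nat}. y [^] i) = y [^] k \<ominus> \<one>"
proof (induction k)
  case (Suc k)
  define S where "S = (\<Oplus>i\<in>{..<k}. y [^] i)"
  define u where "u = y [^] k"
  have c: "S \<in> carrier R" "u \<in> carrier R"
    using assms unfolding S_def u_def by (auto intro!: finsum_closed)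
  have IH: "(y \<ominus> \<one>) \<otimes> S = u \<ominus> \<one>" using Suc by (simp add: S_def u_def)
  have "(\<Oplus>i\<in>{..<Suc k}. y [^] i) = u \<oplus> S"
    unfolding lessThan_Suc S_def u_def using assms by (subst finsum_insert) auto
  then have "(y \<ominus> \<one>) \<otimes> (\<Oplus>i\<in>{..<Suc k}. y [^] i) = (y \<ominus> \<one>) \<otimes> u \<oplus> (u \<ominus> \<one>)"
    using c assms by (simp add: r_distr IH)
  also have "\<dots> = u \<otimes> y \<ominus> \<one>" using c assms by algebra
  finally show ?case by (simp add: u_def)
qed (simp add: assms)

text \<open>Euler's criterion: for x = g^l, the equation x^n = 1 means that k n divides l n.\<close>

lemma pow_eq_one_iff_unit_powers:
  assumes "order R - 1 = k * n" "x \<in> carrier R" "x \<noteq> \<zero>"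
  shows "x [^] n = \<one> \<longleftrightarrow> x \<in> unit_powers R k"
proof
  obtain g where g: "g \<in> carrier R" "g \<noteq> \<zero>"
    and gen: "\<And>x. x \<in> carrier R \<Longrightarrow> x \<noteq> \<zero> \<Longrightarrow> \<exists>i::nat. x = g [^] i"
    and eq: "\<And>i j :: nat. g [^] i = g [^] j \<longleftrightarrow> [i = j] (mod order R - 1)"
    using exists_generator by blast
  obtain l :: nat where l: "x = g [^] l" using gen[OF assms(2,3)] by blast
  assume "x [^] n = \<one>"
  then have "g [^] (l * n) = g [^] (0::nat)" using l g by (simp add: nat_pow_pow)
  then have "k * n dvd l * n" unfolding eq assms(1) by (simp add: cong_0_iff)
  moreover have "n > 0" using assms(1) order_gt_1 by (cases n) auto
  ultimately have "k dvd l" by simp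
  then obtain j where "l = j * k" by (metis dvdE mult.commute)
  then have "x = (g [^] j) [^] k" using g l by (simp add: nat_pow_pow)
  then show "x \<in> unit_powers R k"
    using g by (auto simp: unit_powers_def field_Units nat_pow_nonzero intro!: exI[of _ "g [^] j"])
next
  assume "x \<in> unit_powers R k"
  then obtain y where "y \<in> carrier R" "y \<noteq> \<zero>" "x = y [^] k"
    by (auto simp: unit_powers_def field_Units)
  then show "x [^] n = \<one>" using nonzero_pow_order[of y] assms(1) by (simp add: nat_pow_pow)
qed

text \<open>The map x -> x^n is a character of order k with values in the field itself, so the
  expansion of \<open>num_consecutive_jacobi\<close> can be repeated there, with
  \<open>beta_sum\<close> in place of Jacobi sums. An identity between multiples of one pins down
  the count modulo p.\<close>

lemma consecutive_unit_powers_beta: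
  assumes N: "order R - 1 = k * n" and n: "even n"
  shows "add_pow R (k\<^sup>2 * card {x \<in> unit_powers R k. \<one> \<ominus> x \<in> unit_powers R k} + 2 * k) \<one> =
    add_pow R (\<Sum>i<k. \<Sum>j<k. (j * n choose ((k - i) * n))) (\<ominus> \<one>)"
proof -
  let ?F = "carrier R" and ?U = "unit_powers R k"
  let ?A = "{x \<in> ?U. \<one> \<ominus> x \<in> ?U}"
  have k0: "k > 0" "n > 0" using N order_gt_1 by (cases k; cases n; simp)+
  \<comment> \<open>On nonzero elements this is k times the indicator of the k-th powers; at zero
    the exponent 0 leaves the value one.\<close>
  define T where "T x = (\<Oplus>i\<in>{..<k}. (x [^] n) [^] i)" for x
  have Tc: "T x \<in> ?F" if "x \<in> ?F" for x
    unfolding T_def using that by (intro finsum_closed) auto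
  have T0: "T \<zero> = \<one>"
  proof -
    have "T \<zero> = (\<Oplus>i\<in>insert 0 {0<..<k}. (\<zero>::'a) [^] (i::nat))"
      unfolding T_def using k0 by (intro finsum_cong') (auto simp: nat_pow_zero)
    also have "\<dots> = \<one> \<oplus> (\<Oplus>i\<in>{0<..<k}. (\<zero>::'a) [^] (i::nat))"
      by (subst finsum_insert) auto
    also have "(\<Oplus>i\<in>{0<..<k}. (\<zero>::'a) [^] (i::nat)) = (\<Oplus>i\<in>{0<..<k}. \<zero>)"
      by (intro finsum_cong') (auto simp: nat_pow_zero)
    finally show ?thesis by (simp add: finsum_zero)
  qed
  have T1: "T x = add_pow R k \<one>" if "x \<in> ?U" "x \<in> ?F" "x \<noteq> \<zero>" for x
    using pow_eq_one_iff_unit_powers[OF N that(2,3)] that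
    by (simp add: T_def add.finprod_const)
  have T2: "T x = \<zero>" if "x \<notin> ?U" "x \<in> ?F" "x \<noteq> \<zero>" for x
  proof -
    have "x [^] n \<noteq> \<one>" using pow_eq_one_iff_unit_powers[OF N that(2,3)] that by simp
    moreover have "(x [^] n \<ominus> \<one>) \<otimes> T x = \<zero>"
      using geometric_sum[of "x [^] n" k] that nonzero_pow_order[OF that(2,3)] N
      by (simp add: T_def nat_pow_pow mult.commute)
    ultimately show ?thesis using that Tc[OF that(2)]
      by (metis integral minus_closed nat_pow_closed one_closed r_right_minus_eq)
  qed
  have U1: "\<one> \<in> ?U" using pow_eq_one_iff_unit_powers[OF N, of \<one>] by simp
  have U0: "\<zero> \<notin> ?U"
  proof
    assume "\<zero> \<in> ?U"
    then obtain y where "y \<in> ?F" "y \<noteq> \<zero>" "\<zero> = y [^] k"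
      by (auto simp: unit_powers_def field_Units)
    then show False using nat_pow_nonzero by metis
  qed
  have Uc: "?U \<subseteq> ?F" by (auto simp: unit_powers_def)
  have F: "?F = insert \<zero> (insert \<one> (?F - {\<zero>, \<one>}))" by auto
  have "(\<Oplus>x\<in>?F. T x \<otimes> T (\<one> \<ominus> x)) = T \<zero> \<otimes> T \<one> \<oplus> (T \<one> \<otimes> T \<zero> \<oplus>
      (\<Oplus>x\<in>?F - {\<zero>, \<one>}. T x \<otimes> T (\<one> \<ominus> x)))"
    using Tc by (subst F, subst finsum_insert, simp, simp, force, simp, subst finsum_insert)
      (auto simp: a_minus_def r_neg)
  also have "(\<Oplus>x\<in>?F - {\<zero>, \<one>}. T x \<otimes> T (\<one> \<ominus> x)) =
      (\<Oplus>x\<in>?F - {\<zero>, \<one>}. add_pow R (if x \<in> ?A then k\<^sup>2 else 0) \<one>)"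
  proof (intro finsum_cong' refl)
    fix x assume "x \<in> ?F - {\<zero>, \<one>}"
    then have x: "x \<in> ?F" "x \<noteq> \<zero>" "\<one> \<ominus> x \<in> ?F" "\<one> \<ominus> x \<noteq> \<zero>" by auto
    show "T x \<otimes> T (\<one> \<ominus> x) = add_pow R (if x \<in> ?A then k\<^sup>2 else 0) \<one>"
    proof (cases "x \<in> ?A")
      case True
      then show ?thesis using T1[of x] T1[of "\<one> \<ominus> x"] x
        by (simp add: add_pow_ldistr add.nat_pow_pow power2_eq_square)
    next
      case False
      then have "T x = \<zero> \<or> T (\<one> \<ominus> x) = \<zero>" using T2 x by auto
      then have "T x \<otimes> T (\<one> \<ominus> x) = \<zero>" using Tc[OF x(1)] Tc[OF x(3)] by (elim disjE) simp_all
      moreover have "add_pow R (if x \<in> ?A then k\<^sup>2 else 0) \<one> = \<zero>"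
        unfolding if_not_P[OF False] by simp
      ultimately show ?thesis by simp
    qed
  qed auto
  also have "\<dots> = add_pow R (k\<^sup>2 * card ?A) \<one>"
  proof -
    have "(\<Sum>x\<in>?F - {\<zero>, \<one>}. if x \<in> ?A then k\<^sup>2 else 0) = (\<Sum>x\<in>?A. k\<^sup>2)"
      using Uc U0 by (intro sum.mono_neutral_cong_right) auto
    then show ?thesis by (simp add: finsum_nat_multiple mult.commute)
  qed
  also have "T \<zero> \<otimes> T \<one> \<oplus> (T \<one> \<otimes> T \<zero> \<oplus> add_pow R (k\<^sup>2 * card ?A) \<one>) =
      add_pow R (k\<^sup>2 * card ?A + 2 * k) \<one>"
  proof -
    have "k + (k + M) = M + 2 * k" for M :: nat by simp
    then show ?thesis by (simp only: T0 T1[OF U1] add.nat_pow_mult one_closed one_not_zero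
          l_one r_one add.nat_pow_closed not_False_eq_True)
  qed
  finally have L: "(\<Oplus>x\<in>?F. T x \<otimes> T (\<one> \<ominus> x)) = add_pow R (k\<^sup>2 * card ?A + 2 * k) \<one>" .
  \<comment> \<open>As n is even, x may be replaced by -x, which turns 1 - x into the x + 1 of
    \<open>beta_sum\<close>.\<close>
  have neg: "T (\<ominus> x) = T x" if "x \<in> ?F" for x
  proof -
    have "(\<ominus> x) [^] n = x [^] n"
    proof -
      obtain m where m: "n = 2 * m" using n by (rule dvdE)
      have "(\<ominus> x) [^] (2::nat) = x [^] (2::nat)"
        using that by (simp add: numeral_2_eq_2 l_minus r_minus)
      then have "((\<ominus> x) [^] (2::nat)) [^] m = (x [^] (2::nat)) [^] m" by simp
      then show ?thesis using that m by (simp add: nat_pow_pow)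
    qed
    then show ?thesis by (simp add: T_def)
  qed
  have bij: "bij_betw (\<lambda>x. \<ominus> x) ?F ?F"
    by (rule bij_betwI[where g = "\<lambda>x. \<ominus> x"]) auto
  have "(\<Oplus>x\<in>?F. T x \<otimes> T (\<one> \<ominus> x)) = (\<Oplus>x\<in>?F. T (\<ominus> x) \<otimes> T (\<one> \<ominus> (\<ominus> x)))"
    using Tc by (intro finsum_reindex_bij[OF bij, symmetric]) auto
  also have "\<dots> = (\<Oplus>x\<in>?F. \<Oplus>i\<in>{..<k}. \<Oplus>j\<in>{..<k}. x [^] (i * n) \<otimes> (x \<oplus> \<one>) [^] (j * n))"
  proof (intro finsum_cong' refl)
    fix x assume x: "x \<in> ?F"
    have "\<one> \<ominus> (\<ominus> x) = x \<oplus> \<one>" using x by algebra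
    then have "T (\<ominus> x) \<otimes> T (\<one> \<ominus> (\<ominus> x)) = T x \<otimes> T (x \<oplus> \<one>)" using neg[OF x] by simp
    also have "\<dots> = (\<Oplus>i\<in>{..<k}. (x [^] n) [^] i \<otimes> T (x \<oplus> \<one>))"
      unfolding T_def[of x] using x Tc by (intro finsum_ldistr) auto
    also have "\<dots> = (\<Oplus>i\<in>{..<k}. \<Oplus>j\<in>{..<k}. (x [^] n) [^] i \<otimes> ((x \<oplus> \<one>) [^] n) [^] j)"
      unfolding T_def using x by (intro finsum_cong' refl finsum_rdistr) (auto intro!: finsum_closed)
    finally show "T (\<ominus> x) \<otimes> T (\<one> \<ominus> (\<ominus> x)) =
        (\<Oplus>i\<in>{..<k}. \<Oplus>j\<in>{..<k}. x [^] (i * n) \<otimes> (x \<oplus> \<one>) [^] (j * n))"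
      using x by (simp add: nat_pow_pow mult.commute)
  qed (auto intro!: finsum_closed)
  also have "\<dots> = (\<Oplus>i\<in>{..<k}. \<Oplus>j\<in>{..<k}. \<Oplus>x\<in>?F. x [^] (i * n) \<otimes> (x \<oplus> \<one>) [^] (j * n))"
    by (subst finsum_swap)
      (auto intro!: finsum_closed finsum_cong' finsum_swap)
  also have "\<dots> = (\<Oplus>i\<in>{..<k}. \<Oplus>j\<in>{..<k}. add_pow R (j * n choose ((k - i) * n)) (\<ominus> \<one>))"
  proof (intro finsum_cong' refl)
    fix i j assume ij: "i \<in> {..<k}" "j \<in> {..<k}"
    \<comment> \<open>Both exponents stay below q - 1, as \<open>beta_sum\<close> requires; its
      lower index q - 1 - i n is (k - i) n.\<close>
    have "i * n + j * n < 2 * (order R - 1)"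
    proof -
      have "i * n < k * n" "j * n < k * n" using ij k0 by auto
      then show ?thesis unfolding N by linarith
    qed
    moreover have "i * n \<le> order R - 1" using ij unfolding N by simp
    ultimately show "(\<Oplus>x\<in>?F. x [^] (i * n) \<otimes> (x \<oplus> \<one>) [^] (j * n)) =
        add_pow R (j * n choose ((k - i) * n)) (\<ominus> \<one>)"
      using beta_sum[of "i * n" "j * n"] unfolding N by (simp add: diff_mult_distrib)
  qed (auto intro!: finsum_closed)
  also have "\<dots> = add_pow R (\<Sum>i<k. \<Sum>j<k. (j * n choose ((k - i) * n))) (\<ominus> \<one>)"
    by (simp add: finsum_nat_multiple)
  finally show ?thesis unfolding L .
qed

lemma char_dvd_add:
  assumes "prime p" "order R = p ^ r" "[a] \<cdot> \<one> = [b] \<cdot> (\<ominus> \<one>)"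
  shows "p dvd a + (b::nat)"
proof (rule char_dvd_iff[OF assms(1,2)])
  have "[(a + b)] \<cdot> \<one> = [a] \<cdot> \<one> \<oplus> [b] \<cdot> \<one>" by (simp add: add.nat_pow_mult)
  also have "\<dots> = [b] \<cdot> (\<ominus> \<one> \<oplus> \<one>)"
    unfolding assms(3) by (intro add.pow_mult_distrib[symmetric]) (simp_all add: l_neg r_neg)
  finally show "[(a + b)] \<cdot> \<one> = \<zero>" by (simp add: l_neg)
qed

text \<open>Entries with i + j < 3 vanish. The pairs (1,2) and (2,1) give 1 each, which together
  with 2 k = 6 makes 8, and (2,2) gives the central binomial coefficient.\<close>

lemma char_dvd_cubic:
  assumes p: "prime p" "order R = p ^ r" and N: "order R - 1 = 3 * n" "even n"
  shows "p dvd 9 * card {x \<in> unit_powers R 3. \<one> \<ominus> x \<in> unit_powers R 3} + 8 + (2 * n choose n)"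
proof -
  have "n > 0" using N(1) order_gt_1 by (cases n) auto
  then have S: "(\<Sum>i<3. \<Sum>j<3. (j * n choose ((3 - i) * n))) = 2 + (2 * n choose n)"
    by (simp add: eval_nat_numeral lessThan_Suc binomial_eq_0)
  then show ?thesis
    using char_dvd_add[OF p consecutive_unit_powers_beta[OF N, unfolded S]]
    by (simp add: numeral_eq_Suc)
qed

text \<open>The three pairs with i + j = 4 and the correction 2 k = 8 make up 11. The remaining
  entries C(3n,2n), C(3n,n) and C(2n,n) agree modulo p: \<open>beta_sum\<close> treats its two
  exponents asymmetrically, while the sum is symmetric in them.\<close>

lemma char_dvd_quartic:
  assumes p: "prime p" "order R = p ^ r" and N: "order R - 1 = 4 * n" "even n"
  shows "p dvd 16 * card {x \<in> unit_powers R 4. \<one> \<ominus> x \<in> unit_powers R 4} + 11 + 3 * (3 * n choose n)"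
proof -
  have n0: "n > 0" using N(1) order_gt_1 by (cases n) auto
  have c: "3 * n choose (2 * n) = (3 * n choose n)"
    using binomial_symmetric[of "2 * n" "3 * n"] by simp
  have "add_pow R (3 * n choose n) (\<ominus> \<one>) =
      (\<Oplus>x\<in>carrier R. x [^] (2 * n) \<otimes> (x \<oplus> \<one>) [^] (3 * n))"
    using beta_sum[of "2 * n" "3 * n", unfolded N(1)] n0 c by simp
  also have "\<dots> = (\<Oplus>x\<in>carrier R. x [^] (3 * n) \<otimes> (x \<oplus> \<one>) [^] (2 * n))"
  proof -
    \<comment> \<open>The involution x -> -(x + 1) exchanges x and x + 1 up to sign, and the
      exponents 2 n and 3 n are even.\<close>
    have bij: "bij_betw (\<lambda>x. \<ominus> (x \<oplus> \<one>)) (carrier R) (carrier R)"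
    proof (rule bij_betwI[where g = "\<lambda>x. \<ominus> (x \<oplus> \<one>)"])
      show "\<ominus> (\<ominus> (x \<oplus> \<one>) \<oplus> \<one>) = x" if "x \<in> carrier R" for x using that by algebra
      then show "\<ominus> (\<ominus> (x \<oplus> \<one>) \<oplus> \<one>) = x" if "x \<in> carrier R" for x using that by blast
    qed auto
    have neg: "(\<ominus> x) [^] (2 * m) = x [^] (2 * m)" if "x \<in> carrier R" for x and m :: nat
    proof -
      have "(\<ominus> x) [^] (2::nat) = x [^] (2::nat)"
        using that by (simp add: numeral_2_eq_2 l_minus r_minus)
      then have "((\<ominus> x) [^] (2::nat)) [^] m = (x [^] (2::nat)) [^] m" by simp
      then show ?thesis using that by (simp add: nat_pow_pow)
    qed
    obtain m where m: "n = 2 * m" using N(2) by (rule dvdE)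
    have "(\<Oplus>x\<in>carrier R. x [^] (2 * n) \<otimes> (x \<oplus> \<one>) [^] (3 * n)) =
        (\<Oplus>x\<in>carrier R. (\<ominus> (x \<oplus> \<one>)) [^] (2 * n) \<otimes> (\<ominus> (x \<oplus> \<one>) \<oplus> \<one>) [^] (3 * n))"
      by (rule finsum_reindex_bij[OF bij, symmetric]) auto
    also have "\<dots> = (\<Oplus>x\<in>carrier R. x [^] (3 * n) \<otimes> (x \<oplus> \<one>) [^] (2 * n))"
    proof (intro finsum_cong' refl)
      fix x assume x: "x \<in> carrier R"
      have "\<ominus> (x \<oplus> \<one>) \<oplus> \<one> = \<ominus> x" using x by algebra
      moreover have "(\<ominus> x) [^] (3 * n) = x [^] (3 * n)" using neg[OF x, of "3 * m"] m by simp
      moreover have "(\<ominus> (x \<oplus> \<one>)) [^] (2 * n) = (x \<oplus> \<one>) [^] (2 * n)"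
        using neg[of "x \<oplus> \<one>" n] x by simp
      ultimately show "(\<ominus> (x \<oplus> \<one>)) [^] (2 * n) \<otimes> (\<ominus> (x \<oplus> \<one>) \<oplus> \<one>) [^] (3 * n) =
          x [^] (3 * n) \<otimes> (x \<oplus> \<one>) [^] (2 * n)"
        using x by (simp add: m_comm)
    qed auto
    finally show ?thesis .
  qed
  also have "\<dots> = add_pow R (2 * n choose n) (\<ominus> \<one>)"
    using beta_sum[of "3 * n" "2 * n", unfolded N(1)] n0 by simp
  finally have e: "add_pow R (3 * n choose n) (\<ominus> \<one>) = add_pow R (2 * n choose n) (\<ominus> \<one>)" .
  have "(\<Sum>i<4. \<Sum>j<4. (j * n choose ((4 - i) * n))) =
      (3 + 2 * (3 * n choose n)) + (2 * n choose n)"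
    using n0 c by (simp add: eval_nat_numeral lessThan_Suc binomial_eq_0)
  then have S: "add_pow R (\<Sum>i<4. \<Sum>j<4. (j * n choose ((4 - i) * n))) (\<ominus> \<one>) =
      add_pow R (3 * (3 * n choose n) + 3) (\<ominus> \<one>)"
    using e add.nat_pow_mult[of "\<ominus> \<one>" "3 + 2 * (3 * n choose n)" "2 * n choose n"]
      add.nat_pow_mult[of "\<ominus> \<one>" "3 + 2 * (3 * n choose n)" "3 * n choose n"] by simp
  then show ?thesis
    using char_dvd_add[OF p consecutive_unit_powers_beta[OF N, unfolded S]]
    by (simp add: numeral_eq_Suc)
qed

end

section \<open>Triangles in Cayley graphs\<close>

lemma sum_card_fibres:
  assumes "finite A" "finite B" "f ` A \<subseteq> B" "\<And>y. y \<in> B \<Longrightarrow> card {x \<in> A. f x = y} = m"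
  shows "card A = m * card B"
proof -
  have "card A = (\<Sum>y\<in>B. \<Sum>x\<in>{x \<in> A. f x = y}. 1)"
    using sum.group[OF assms(1-3), of "\<lambda>_. 1::nat"] by simp
  also have "\<dots> = (\<Sum>y\<in>B. m)" using assms(4) by (intro sum.cong) auto
  finally show ?thesis by simp
qed

text \<open>A complete subgraph has all pairs of distinct vertices as arcs and inherits
  \<open>tail\<close> and \<open>head\<close>, so its vertex set determines it.\<close>

lemma num_cliques_pair_digraph:
  fixes G :: "'a pair_pre_digraph"
  assumes wf: "parcs G \<subseteq> pverts G \<times> pverts G" and n: "0 < n"
  shows "num_cliques n (with_proj G) =
    card {S. S \<subseteq> pverts G \<and> card S = n \<and> (\<forall>u\<in>S. \<forall>v\<in>S. u \<noteq> v \<longrightarrow> (u, v) \<in> parcs G)}"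
    (is "_ = card ?C")
proof -
  define K :: "'a set \<Rightarrow> 'a pair_pre_digraph" where
    "K S = \<lparr>pverts = S, parcs = {(u, v). (u, v) \<in> S \<times> S \<and> u \<noteq> v}\<rparr>" for S
  have "bij_betw (\<lambda>S. with_proj (K S)) ?C
      {H. subgraph H (with_proj G) \<and> complete_digraph n H}"
  proof (rule bij_betwI[where g = verts])
    show "(\<lambda>S. with_proj (K S)) \<in> ?C \<rightarrow> {H. subgraph H (with_proj G) \<and> complete_digraph n H}"
    proof
      fix S assume S: "S \<in> ?C"
      \<comment> \<open>A positive cardinality rules out infinite S, for which \<open>card\<close>
        is 0.\<close>
      then have "finite S" using n by (auto intro: card_ge_0_finite)
      then have "complete_digraph n (with_proj (K S))"
        using S by (simp add: complete_digraph_pair_def K_def)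
      moreover have "subgraph (with_proj (K S)) (with_proj G)"
        using S wf unfolding subgraph_def compatible_def wf_digraph_def K_def by auto
      ultimately show "with_proj (K S) \<in> {H. subgraph H (with_proj G) \<and> complete_digraph n H}"
        by simp
    qed
    have arcs: "arcs H = {(u, v). (u, v) \<in> verts H \<times> verts H \<and> u \<noteq> v} \<and> tail H = fst \<and> head H = snd"
      if H: "subgraph H (with_proj G)" "complete_digraph n H" for H
    proof -
      have th: "tail H = fst" "head H = snd"
        using H(1) by (auto simp: subgraph_def compatible_def)
      then have "arcs_ends H = arcs H" by (simp add: arcs_ends_def arc_to_ends_def)
      then show ?thesis using H(2) th by (simp add: complete_digraph_def)
    qed
    show "verts \<in> {H. subgraph H (with_proj G) \<and> complete_digraph n H} \<rightarrow> ?C"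
    proof
      fix H assume "H \<in> {H. subgraph H (with_proj G) \<and> complete_digraph n H}"
      then have H: "subgraph H (with_proj G)" "complete_digraph n H" by auto
      have "verts H \<subseteq> pverts G" "arcs H \<subseteq> parcs G" using H(1) by (auto simp: subgraph_def)
      moreover have "card (verts H) = n" using H(2) by (simp add: complete_digraph_def)
      ultimately show "verts H \<in> ?C" using arcs[OF H] by auto
    qed
    show "with_proj (K (verts H)) = H"
      if "H \<in> {H. subgraph H (with_proj G) \<and> complete_digraph n H}" for H
    proof -
      have H: "subgraph H (with_proj G)" "complete_digraph n H" using that by auto
      show ?thesis using arcs[OF H] by (simp add: K_def with_proj_def)
    qed
  qed (simp add: K_def)
  then show ?thesis unfolding num_cliques_def by (simp add: bij_betw_same_card)
qed

lemma card_orderings_three: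
  fixes S :: "'a set"
  assumes "card S = 3"
  shows "card {(u, v, w). u \<noteq> v \<and> v \<noteq> w \<and> u \<noteq> w \<and> {u, v, w} = S} = 6"
proof -
  obtain a b c where S: "S = {a, b, c}" and d: "a \<noteq> b" "b \<noteq> c" "a \<noteq> c"
    using assms by (auto simp: card_3_iff)
  have "{(u, v, w). u \<noteq> v \<and> v \<noteq> w \<and> u \<noteq> w \<and> {u, v, w} = S} =
      {(a, b, c), (a, c, b), (b, a, c), (b, c, a), (c, a, b), (c, b, a)}"
    (is "?L = ?R")
  proof (intro Set.set_eqI)
    fix t :: "'a \<times> 'a \<times> 'a"
    obtain u v w where t: "t = (u, v, w)" by (cases t)
    show "t \<in> ?L \<longleftrightarrow> t \<in> ?R" unfolding t
    proof
      assume "(u, v, w) \<in> ?L"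
      then have uvw: "u \<noteq> v" "v \<noteq> w" "u \<noteq> w" "{u, v, w} = {a, b, c}" unfolding S by auto
      then have "u \<in> {a, b, c}" "v \<in> {a, b, c}" "w \<in> {a, b, c}" by blast+
      then show "(u, v, w) \<in> ?R" using uvw(1-3) by auto
    qed (use d in \<open>auto simp: S\<close>)
  qed
  then show ?thesis using d by simp
qed

text \<open>Irreflexivity makes the vertices of each triple distinct, so by symmetry every triangle
  arises from its six orderings.\<close>

lemma num_triangles_pair_digraph:
  fixes G :: "'a pair_pre_digraph"
  assumes wf: "parcs G \<subseteq> pverts G \<times> pverts G" and fin: "finite (pverts G)"
    and sym: "sym (parcs G)" and irrefl: "irrefl (parcs G)"
  shows "6 * num_cliques 3 (with_proj G) =
    card {(u, v, w). (u, v) \<in> parcs G \<and> (v, w) \<in> parcs G \<and> (u, w) \<in> parcs G}"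
proof -
  let ?C = "{S. S \<subseteq> pverts G \<and> card S = 3 \<and> (\<forall>u\<in>S. \<forall>v\<in>S. u \<noteq> v \<longrightarrow> (u, v) \<in> parcs G)}"
  let ?T = "{(u, v, w). (u, v) \<in> parcs G \<and> (v, w) \<in> parcs G \<and> (u, w) \<in> parcs G}"
  let ?f = "\<lambda>(u, v, w). {u, v, w}"
  have ne: "u \<noteq> v" if "(u, v) \<in> parcs G" for u v using that irrefl by (auto simp: irrefl_def)
  have "card ?T = 6 * card ?C"
  proof (rule sum_card_fibres[where f = ?f])
    have "?T \<subseteq> pverts G \<times> pverts G \<times> pverts G" using wf by auto
    then show "finite ?T" using fin by (meson finite_SigmaI finite_subset)
    show "finite ?C" using fin by simp
    show "?f ` ?T \<subseteq> ?C"
    proof (rule image_subsetI, clarify)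
      fix u v w assume a: "(u, v) \<in> parcs G" "(v, w) \<in> parcs G" "(u, w) \<in> parcs G"
      then have "u \<noteq> v" "v \<noteq> w" "u \<noteq> w" using ne by blast+
      moreover have "(v, u) \<in> parcs G" "(w, v) \<in> parcs G" "(w, u) \<in> parcs G"
        using a sym by (auto dest: symD)
      ultimately show "{u, v, w} \<subseteq> pverts G \<and> card {u, v, w} = 3 \<and>
          (\<forall>x\<in>{u, v, w}. \<forall>y\<in>{u, v, w}. x \<noteq> y \<longrightarrow> (x, y) \<in> parcs G)"
        using a wf by auto
    qed
    fix S assume S: "S \<in> ?C"
    have "{t \<in> ?T. ?f t = S} = {(u, v, w). u \<noteq> v \<and> v \<noteq> w \<and> u \<noteq> w \<and> {u, v, w} = S}"
      using S ne by auto
    then show "card {t \<in> ?T. ?f t = S} = 6" using card_orderings_three[of S] S by simp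
  qed
  then show ?thesis using num_cliques_pair_digraph[OF wf, of 3] by simp
qed

text \<open>Translation moves the first vertex to zero and leaves a pair of differences that does
  not constrain that vertex, whence the factor \<open>order R\<close>.\<close>

lemma (in ring) num_triangles_cayley_graph:
  assumes fin: "finite (carrier R)" and S: "S \<subseteq> carrier R" "\<zero> \<notin> S" "\<And>x. x \<in> S \<Longrightarrow> \<ominus> x \<in> S"
  shows "6 * num_cliques 3 (with_proj (cayley_graph R S)) =
    order R * card {(a, b). a \<in> S \<and> b \<in> S \<and> b \<ominus> a \<in> S}"
proof -
  let ?G = "cayley_graph R S" and ?T = "{(a, b). a \<in> S \<and> b \<in> S \<and> b \<ominus> a \<in> S}"
  let ?V = "{(u, v, w). (u, v) \<in> parcs ?G \<and> (v, w) \<in> parcs ?G \<and> (u, w) \<in> parcs ?G}"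
  have "6 * num_cliques 3 (with_proj ?G) = card ?V"
  proof (rule num_triangles_pair_digraph[of ?G])
    show "sym (parcs ?G)"
    proof (rule symI)
      fix u v assume "(u, v) \<in> parcs ?G"
      then have uv: "u \<in> carrier R" "v \<in> carrier R" "v \<ominus> u \<in> S" by (auto simp: cayley_graph_def)
      have "u \<ominus> v = \<ominus> (v \<ominus> u)" using uv by algebra
      then show "(v, u) \<in> parcs ?G" using uv S(3) by (simp add: cayley_graph_def)
    qed
    show "irrefl (parcs ?G)"
      using S(2) by (auto simp: cayley_graph_def irrefl_def minus_eq r_neg)
  qed (use fin in \<open>auto simp: cayley_graph_def\<close>)
  also have "card ?V = card (carrier R \<times> ?T)"
  proof (rule bij_betw_same_card, rule bij_betwI[where f = "\<lambda>(u, v, w). (u, v \<ominus> u, w \<ominus> u)"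
        and g = "\<lambda>(u, a, b). (u, u \<oplus> a, u \<oplus> b)"])
    show "(\<lambda>(u, v, w). (u, v \<ominus> u, w \<ominus> u)) \<in> ?V \<rightarrow> carrier R \<times> ?T"
    proof
      fix t assume "t \<in> ?V"
      then obtain u v w where t: "t = (u, v, w)"
        and a: "(u, v) \<in> parcs ?G" "(v, w) \<in> parcs ?G" "(u, w) \<in> parcs ?G" by auto
      then have c: "u \<in> carrier R" "v \<in> carrier R" "w \<in> carrier R" by (auto simp: cayley_graph_def)
      have "w \<ominus> u \<ominus> (v \<ominus> u) = w \<ominus> v" using c by algebra
      then show "(case t of (u, v, w) \<Rightarrow> (u, v \<ominus> u, w \<ominus> u)) \<in> carrier R \<times> ?T"
        using a c by (simp add: t cayley_graph_def)
    qed
    show "(\<lambda>(u, a, b). (u, u \<oplus> a, u \<oplus> b)) \<in> carrier R \<times> ?T \<rightarrow> ?V"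
    proof
      fix t assume "t \<in> carrier R \<times> ?T"
      then obtain u a b where t: "t = (u, a, b)"
        and a: "u \<in> carrier R" "a \<in> S" "b \<in> S" "b \<ominus> a \<in> S" by auto
      then have c: "a \<in> carrier R" "b \<in> carrier R" using S(1) by auto
      have "u \<oplus> a \<ominus> u = a" "u \<oplus> b \<ominus> u = b" "u \<oplus> b \<ominus> (u \<oplus> a) = b \<ominus> a"
        using a(1) c by algebra+
      then show "(case t of (u, a, b) \<Rightarrow> (u, u \<oplus> a, u \<oplus> b)) \<in> ?V"
        using a c by (simp add: t cayley_graph_def)
    qed
    show "(\<lambda>(u, a, b). (u, u \<oplus> a, u \<oplus> b)) ((\<lambda>(u, v, w). (u, v \<ominus> u, w \<ominus> u)) t) = t" if "t \<in> ?V" for t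
    proof -
      obtain u v w where t: "t = (u, v, w)" by (cases t)
      then have c: "u \<in> carrier R" "v \<in> carrier R" "w \<in> carrier R"
        using that by (auto simp: cayley_graph_def)
      have "u \<oplus> (v \<ominus> u) = v" "u \<oplus> (w \<ominus> u) = w" using c by algebra+
      then show ?thesis by (simp add: t)
    qed
    show "(\<lambda>(u, v, w). (u, v \<ominus> u, w \<ominus> u)) ((\<lambda>(u, a, b). (u, u \<oplus> a, u \<oplus> b)) t) = t"
      if "t \<in> carrier R \<times> ?T" for t
    proof -
      obtain u a b where t: "t = (u, a, b)" by (cases t)
      then have c: "u \<in> carrier R" "a \<in> carrier R" "b \<in> carrier R"
        using that S(1) by auto
      have "u \<oplus> a \<ominus> u = a" "u \<oplus> b \<ominus> u = b" using c by algebra+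
      then show ?thesis by (simp add: t)
    qed
  qed
  finally show ?thesis by (simp add: card_cartesian_product order_def)
qed

section \<open>Reduction to the residue field\<close>

context power_residue_character
begin

text \<open>Summed over the field, the character expansion of the indicator keeps only the exponent
  0, with value q; its value 1 at zero accounts for the subtracted 1.\<close>

lemma card_unit_powers: "k * card (unit_powers R k) = order R - 1"
proof -
  have "complex_of_nat (order R) = (\<Sum>i<k. \<Sum>x\<in>carrier R. \<chi> x ^ i)"
  proof -
    have "(\<Sum>i<k. \<Sum>x\<in>carrier R. \<chi> x ^ i) = (\<Sum>i<k. if i = 0 then of_nat (order R) else 0)"
      using sum_char_power by (intro sum.cong) (auto simp: order_def)
    then show ?thesis using two_le by simp
  qed
  also have "\<dots> = (\<Sum>x\<in>carrier R. \<Sum>i<k. \<chi> x ^ i)" by (rule sum.swap)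
  also have "\<dots> = (\<Sum>x\<in>carrier R. (if x = \<zero> then 1 else 0) + (if x \<in> unit_powers R k then of_nat k else 0))"
    by (intro sum.cong refl) (auto simp: sum_powers_char)
  also have "\<dots> = 1 + of_nat (card (unit_powers R k)) * of_nat k"
    unfolding sum.distrib sum.inter_restrict[symmetric, OF finite_carrier]
    by (simp add: sum.delta Int_absorb1 unit_powers_closed)
  finally have "complex_of_nat (order R) = complex_of_nat (1 + card (unit_powers R k) * k)" by simp
  then have "order R = 1 + card (unit_powers R k) * k" by (simp only: of_nat_eq_iff)
  then show ?thesis by simp
qed

text \<open>Scaling by a k-th power preserves all three conditions, so dividing by b normalises the
  pair to (a/b, 1).\<close>

lemma card_unit_power_pairs:
  "card {(a, b). a \<in> unit_powers R k \<and> b \<in> unit_powers R k \<and> b \<ominus> a \<in> unit_powers R k} =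
    card (unit_powers R k) * num_consecutive"
proof -
  let ?U = "unit_powers R k" and ?A = "{x \<in> unit_powers R k. \<one> \<ominus> x \<in> unit_powers R k}"
  let ?T = "{(a, b). a \<in> ?U \<and> b \<in> ?U \<and> b \<ominus> a \<in> ?U}"
  have U: "x \<in> ?U \<longleftrightarrow> x \<in> carrier R \<and> \<chi> x = 1" for x
    using char_eq_1_iff unit_powers_closed by auto
  have nz: "x \<noteq> \<zero>" if "\<chi> x = 1" for x using that by auto
  have "bij_betw (\<lambda>(d, x). (d \<otimes> x, d)) (?U \<times> ?A) ?T"
  proof (rule bij_betwI[where g = "\<lambda>(a, b). (b, inv b \<otimes> a)"])
    have d: "d \<ominus> d \<otimes> x = d \<otimes> (\<one> \<ominus> x)" if "d \<in> carrier R" "x \<in> carrier R" for d x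
      using that by algebra
    show "(\<lambda>(d, x). (d \<otimes> x, d)) \<in> ?U \<times> ?A \<rightarrow> ?T"
      by (auto simp: U d char_mult)
    have e: "\<one> \<ominus> inv b \<otimes> a = inv b \<otimes> (b \<ominus> a)" if "a \<in> carrier R" "b \<in> carrier R" "b \<noteq> \<zero>" for a b
    proof -
      have "inv b \<otimes> (b \<ominus> a) = inv b \<otimes> b \<ominus> inv b \<otimes> a"
        using that(1,2) inv_closed[OF that(2,3)] by algebra
      then show ?thesis using that by simp
    qed
    show "(\<lambda>(a, b). (b, inv b \<otimes> a)) \<in> ?T \<rightarrow> ?U \<times> ?A"
      using nz by (auto simp: U e char_mult char_inv)
    show "(\<lambda>(a, b). (b, inv b \<otimes> a)) ((\<lambda>(d, x). (d \<otimes> x, d)) t) = t" if "t \<in> ?U \<times> ?A" for t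
      using that nz by (auto simp: U simp flip: m_assoc)
    show "(\<lambda>(d, x). (d \<otimes> x, d)) ((\<lambda>(a, b). (b, inv b \<otimes> a)) t) = t" if "t \<in> ?T" for t
      using that nz by (auto simp: U simp flip: m_assoc)
  qed
  then have "card ?T = card (?U \<times> ?A)" by (simp add: bij_betw_same_card)
  then show ?thesis by (simp add: card_cartesian_product num_consecutive_def)
qed

end

section \<open>Finite local rings and the residue map\<close>

locale finite_local_ring = local_ring R M for R (structure) and M +
  assumes finite_carrier [simp, intro]: "finite (carrier R)"
begin

abbreviation residue :: "'a \<Rightarrow> 'a set" where
  "residue x \<equiv> M +> x"

abbreviation residue_field :: "'a set ring" where
  "residue_field \<equiv> R Quot M"

lemma residue_hom: "residue \<in> ring_hom R residue_field"
  by (rule rcos_ring_hom)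

lemma residue_ring_hom_cring: "ring_hom_cring R residue_field residue"
  by (intro ring_hom_cring.intro ring_hom_cring_axioms.intro cring_axioms
      quotient_is_cring residue_hom)

lemmas residue_closed = ring_hom_closed[OF residue_hom]
  and residue_mult = ring_hom_mult[OF residue_hom]
  and residue_add = ring_hom_add[OF residue_hom]
  and residue_one = ring_hom_one[OF residue_hom]
  and residue_zero = ring_hom_cring.hom_zero[OF residue_ring_hom_cring]
  and residue_a_inv = ring_hom_cring.hom_a_inv[OF residue_ring_hom_cring]

lemma residue_nat_pow:
  "x \<in> carrier R \<Longrightarrow> residue (x [^] (n::nat)) = residue x [^]\<^bsub>residue_field\<^esub> n"
  by (induction n) (simp_all add: residue_one residue_mult)

lemma residue_minus:
  "x \<in> carrier R \<Longrightarrow> y \<in> carrier R \<Longrightarrow>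
    residue (x \<ominus> y) = residue x \<ominus>\<^bsub>residue_field\<^esub> residue y"
  by (simp add: a_minus_def residue_add residue_a_inv)

lemma finite_field_residue_field: "finite_field residue_field"
proof (intro finite_field.intro finite_field_axioms.intro)
  show "field residue_field" by (rule quotient_is_field[OF cring_axioms])
  have "carrier residue_field \<subseteq> Pow (carrier R)"
    using a_rcosets_part_G by (auto simp: FactRing_def)
  then show "finite (carrier residue_field)"
    by (rule finite_subset) (simp add: finite_carrier)
qed

lemma residue_eq_iff:
  assumes "x \<in> carrier R" "y \<in> carrier R"
  shows "residue x = residue y \<longleftrightarrow> x \<ominus> y \<in> M"
proof -
  have "residue x = residue y \<longleftrightarrow> x \<in> residue y"
    using a_rcos_self[OF assms(1)] a_repr_independence'[OF _ assms(2)] by metis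
  then show ?thesis using a_rcos_module_minus[OF ring_axioms assms(2,1)] by simp
qed

lemma residue_eq_zero_iff:
  "x \<in> carrier R \<Longrightarrow> residue x = \<zero>\<^bsub>residue_field\<^esub> \<longleftrightarrow> x \<in> M"
  using residue_eq_iff[of x \<zero>] by (simp add: minus_eq residue_zero)

lemma residue_fibre:
  assumes "c \<in> carrier residue_field"
  shows "{x \<in> carrier R. residue x = c} = c"
proof -
  obtain y where y: "y \<in> carrier R" "c = residue y"
    using assms by (auto simp: FactRing_def A_RCOSETS_def')
  have "c \<subseteq> carrier R" using y a_r_coset_subset_G[OF a_subset] by simp
  moreover have "residue x = residue y \<longleftrightarrow> x \<in> residue y" if "x \<in> carrier R" for x
    using residue_eq_iff[OF that y(1)] a_rcos_module_minus[OF ring_axioms y(1) that] by simp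
  ultimately show ?thesis using y by blast
qed

lemma card_residue_class:
  assumes "c \<in> carrier residue_field"
  shows "card c = card M"
  using assms a_card_cosets_equal[of c M] a_subset by (simp add: FactRing_def finite_subset)

lemma residue_surj:
  assumes "c \<in> carrier residue_field"
  obtains x where "x \<in> carrier R" "residue x = c"
  using assms by (auto simp: FactRing_def A_RCOSETS_def')

lemma order_eq: "order R = order residue_field * card M"
  using a_lagrange[OF finite_carrier is_additive_subgroup]
  by (simp add: order_def FactRing_def)

text \<open>Finiteness provides a maximal element among the proper ideals above I, in place of
  Zorn's lemma.\<close>

lemma subset_maximalideal:
  assumes "ideal I R" "I \<noteq> carrier R"
  shows "\<exists>J. maximalideal J R \<and> I \<subseteq> J"
proof -
  define A where "A = {J. ideal J R \<and> I \<subseteq> J \<and> J \<noteq> carrier R}"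
  have "A \<subseteq> Pow (carrier R)" using ideal.Icarr by (fastforce simp: A_def)
  then have "finite A" by (meson finite_carrier finite_Pow_iff finite_subset)
  moreover have "I \<in> A" using assms by (simp add: A_def)
  ultimately obtain J where J: "J \<in> A" "\<And>K. K \<in> A \<Longrightarrow> J \<subseteq> K \<Longrightarrow> K = J"
    using finite_has_maximal[of A] by blast
  have "maximalideal J R"
  proof (rule maximalidealI)
    fix K assume "ideal K R" "J \<subseteq> K" "K \<subseteq> carrier R"
    then show "K = J \<or> K = carrier R"
      using J(1) J(2)[of K] by (cases "K = carrier R") (auto simp: A_def)
  qed (use J(1) in \<open>auto simp: A_def\<close>)
  then show ?thesis using J(1) by (auto simp: A_def)
qed

text \<open>A nonunit generates a proper ideal; this lies in some maximal ideal, which by uniqueness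
  is M.\<close>

lemma Units_iff: "x \<in> Units R \<longleftrightarrow> x \<in> carrier R \<and> x \<notin> M"
proof
  assume x: "x \<in> Units R"
  have "x \<notin> M"
  proof
    assume "x \<in> M"
    then have "inv x \<otimes> x \<in> M" using x by (intro I_l_closed) auto
    then show False using x I_notcarr one_imp_carrier by simp
  qed
  then show "x \<in> carrier R \<and> x \<notin> M" using x by auto
next
  assume x: "x \<in> carrier R \<and> x \<notin> M"
  show "x \<in> Units R"
  proof (rule ccontr)
    assume nu: "x \<notin> Units R"
    have "ideal (PIdl x) R" using x by (intro cgenideal_ideal) simp
    moreover have "PIdl x \<noteq> carrier R"
    proof
      assume "PIdl x = carrier R"
      then have "\<one> \<in> PIdl x" by simp
      then obtain y where "y \<in> carrier R" "\<one> = y \<otimes> x" by (auto simp: cgenideal_def)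
      then show False using nu x m_comm[of x y] by (auto simp: Units_def)
    qed
    ultimately obtain J where J: "maximalideal J R" "PIdl x \<subseteq> J" using subset_maximalideal by blast
    then have "J = M" using unique_maximalideal by simp
    then show False using J(2) cgenideal_self[of x] x by auto
  qed
qed

lemma residue_Units_iff:
  assumes "x \<in> carrier R"
  shows "residue x \<in> Units residue_field \<longleftrightarrow> x \<in> Units R"
proof -
  interpret F: finite_field residue_field by (rule finite_field_residue_field)
  show ?thesis using assms residue_eq_zero_iff[OF assms] by (simp add: F.field_Units Units_iff residue_closed)
qed

text \<open>
  The group \<open>1 + M\<close> has order \<open>card M\<close>, so raising to a power coprime to \<open>card M\<close> is surjective on it.
\<close>

lemma one_plus_maximalideal_power:
  assumes k: "coprime k (card M)" and y: "y \<in> carrier R" "residue y = \<one>\<^bsub>residue_field\<^esub>"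
  shows "\<exists>z\<in>Units R. z [^] k = y"
proof -
  \<comment> \<open>This is 1 + M, written as the fibre of the residue map over one so that
    \<open>residue_fibre\<close> gives its size.\<close>
  let ?H = "{x \<in> carrier R. residue x = \<one>\<^bsub>residue_field\<^esub>}"
  interpret F: finite_field residue_field by (rule finite_field_residue_field)
  interpret U: group "units_of R" by (rule units_group)
  have HU: "x \<in> Units R" if "x \<in> ?H" for x
    using that residue_Units_iff[of x] by auto
  have sub: "subgroup ?H (units_of R)"
  proof (rule U.subgroupI)
    show "?H \<subseteq> carrier (units_of R)" using HU by (auto simp: units_of_def)
    show "?H \<noteq> {}" using residue_one by blast
    show "inv\<^bsub>units_of R\<^esub> x \<in> ?H" if "x \<in> ?H" for x
    proof -
      have x: "x \<in> Units R" "x \<in> carrier R" using that HU by auto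
      have "residue (inv x) = residue (inv x) \<otimes>\<^bsub>residue_field\<^esub> residue x"
        using that x by (simp add: residue_closed)
      also have "\<dots> = residue (inv x \<otimes> x)" using x by (simp only: residue_mult Units_inv_closed)
      also have "\<dots> = \<one>\<^bsub>residue_field\<^esub>" using x by (simp add: residue_one)
      finally show ?thesis using x by (simp add: units_of_inv)
    qed
    show "x \<otimes>\<^bsub>units_of R\<^esub> w \<in> ?H" if "x \<in> ?H" "w \<in> ?H" for x w
      using that by (simp add: units_of_mult residue_mult)
  qed
  have "card ?H = card M"
    using residue_fibre[OF F.one_closed] card_residue_class[OF F.one_closed] by simp
  moreover interpret H: group "units_of R\<lparr>carrier := ?H\<rparr>"
    by (rule subgroup.subgroup_is_group[OF sub U.group_axioms])
  have pow: "x [^]\<^bsub>units_of R\<lparr>carrier := ?H\<rparr>\<^esub> (n::nat) = x [^] n" if "x \<in> Units R" for x n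
    using units_of_pow[OF that, of n] by (simp add: nat_pow_def)
  have "y [^] (card M) = \<one>"
    using H.pow_order_eq_1[of y] pow[of y "card M"] HU[of y] y \<open>card ?H = card M\<close>
    by (simp add: order_def units_of_one)
  moreover obtain s where "[k * s = 1] (mod card M)"
    using cong_solve_coprime_nat[OF k] by auto
  ultimately have "y [^] (k * s) = y"
  proof -
    have yU: "y \<in> Units R" using HU y by simp
    \<comment> \<open>The inverse of k modulo \<open>card M\<close> enters through an additive
      relation between naturals, so that no exponent is subtracted.\<close>
    obtain a b where "1 + b * card M = k * s + a * card M"
      using \<open>[k * s = 1] (mod card M)\<close> by (auto simp: cong_iff_lin_nat)
    then have ab: "k * s + card M * a = 1 + card M * b" by (simp add: mult.commute)
    have M: "y [^] (card M * i) = \<one>" for i :: nat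
      using \<open>y [^] (card M) = \<one>\<close> y(1) by (simp flip: nat_pow_pow)
    have "y [^] (k * s) = y [^] (k * s + card M * a)"
      using y(1) M by (simp flip: nat_pow_mult)
    also have "\<dots> = y" unfolding ab using y(1) M by (simp flip: nat_pow_mult)
    finally show ?thesis .
  qed
  then have "(y [^] s) [^] k = y" using y(1) by (simp add: nat_pow_pow mult.commute)
  moreover have "y [^] s \<in> Units R" using HU y by (simp add: Units_pow_closed)
  ultimately show ?thesis by blast
qed

text \<open>A k-th root of the residue of x lifts to a unit z; the quotient of x by z^k lies in 1 +
  M and is therefore itself a k-th power.\<close>

lemma unit_powers_residue_iff:
  assumes k: "coprime k (card M)"
  shows "x \<in> unit_powers R k \<longleftrightarrow> x \<in> carrier R \<and> residue x \<in> unit_powers residue_field k"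
proof
  assume "x \<in> unit_powers R k"
  then obtain z where z: "z \<in> Units R" "x = z [^] k" by (auto simp: unit_powers_def)
  then have "residue x = residue z [^]\<^bsub>residue_field\<^esub> k" by (simp add: residue_nat_pow Units_closed)
  then show "x \<in> carrier R \<and> residue x \<in> unit_powers residue_field k"
    using z residue_Units_iff[of z] by (auto simp: unit_powers_def)
next
  interpret F: finite_field residue_field by (rule finite_field_residue_field)
  assume x: "x \<in> carrier R \<and> residue x \<in> unit_powers residue_field k"
  then obtain c where c: "c \<in> Units residue_field" "residue x = c [^]\<^bsub>residue_field\<^esub> k"
    by (auto simp: unit_powers_def)
  then obtain z where z: "z \<in> carrier R" "residue z = c"
    using residue_surj by (metis F.Units_closed)
  then have zU: "z \<in> Units R" using residue_Units_iff c by blast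
  define y where "y = x \<otimes> inv (z [^] k)"
  have zk: "z [^] k \<in> Units R" using zU by (simp add: Units_pow_closed)
  have y: "y \<in> carrier R" using x zk by (simp add: y_def)
  have "residue y \<otimes>\<^bsub>residue_field\<^esub> residue (z [^] k) = residue (y \<otimes> z [^] k)"
    using y z by (simp add: residue_mult)
  also have "y \<otimes> z [^] k = x" using conjunct1[OF x] zk by (simp add: y_def m_assoc Units_closed)
  also have "residue x = residue (z [^] k)" using c z by (simp add: residue_nat_pow Units_closed)
  finally have "residue y = \<one>\<^bsub>residue_field\<^esub>"
    using y z zk residue_Units_iff[of "z [^] k"]
    by (metis F.Units_r_inv F.m_assoc F.r_one F.Units_inv_closed residue_closed nat_pow_closed)
  then obtain w where w: "w \<in> Units R" "w [^] k = y"
    using one_plus_maximalideal_power[OF k y] by blast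
  have "x = (w \<otimes> z) [^] k"
    using \<open>y \<otimes> z [^] k = x\<close> w z by (simp add: nat_pow_distrib Units_closed)
  then show "x \<in> unit_powers R k" using w zU by (auto simp: unit_powers_def)
qed

text \<open>One factor \<open>card M\<close> comes from the order of R and two from lifting the pair
  (a, b) along the residue map. The factor k on the left turns the number of k-th powers into q -
  1.\<close>

lemma num_triangles_unit_power_graph:
  assumes k: "2 \<le> k" "coprime k (card M)"
    and \<chi>: "power_residue_character residue_field \<chi> k"
  shows "6 * k * num_cliques 3 (with_proj (unit_power_graph R k)) =
    card M ^ 3 * order residue_field * (order residue_field - 1) *
    power_residue_character.num_consecutive residue_field k"
proof -
  interpret F: power_residue_character residue_field \<chi> k by (rule \<chi>)
  let ?U = "unit_powers R k" and ?V = "unit_powers residue_field k"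
  let ?T = "{(a, b). a \<in> ?U \<and> b \<in> ?U \<and> b \<ominus> a \<in> ?U}"
  let ?S = "{(a, b). a \<in> ?V \<and> b \<in> ?V \<and> b \<ominus>\<^bsub>residue_field\<^esub> a \<in> ?V}"
  note U = unit_powers_residue_iff[OF k(2)]
  have V: "?V \<subseteq> carrier residue_field" by (rule F.unit_powers_closed)
  have "card ?T = (card M)\<^sup>2 * card ?S"
  proof (rule sum_card_fibres[where f = "map_prod residue residue"])
    have "?T \<subseteq> carrier R \<times> carrier R" by (auto simp: U)
    then show "finite ?T" by (meson finite_SigmaI finite_carrier finite_subset)
    have "?S \<subseteq> carrier residue_field \<times> carrier residue_field" using V by auto
    then show "finite ?S" by (meson finite_SigmaI F.finite_carrier finite_subset)
    show "map_prod residue residue ` ?T \<subseteq> ?S" by (auto simp: U residue_minus residue_closed)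
    fix t assume t: "t \<in> ?S"
    obtain c d where cd: "t = (c, d)" by (cases t)
    have cd': "c \<in> carrier residue_field" "d \<in> carrier residue_field" using t V cd by auto
    have "{s \<in> ?T. map_prod residue residue s = t} =
        {x \<in> carrier R. residue x = c} \<times> {x \<in> carrier R. residue x = d}"
      using t unfolding cd by (auto simp: U residue_minus residue_closed)
    also have "\<dots> = c \<times> d" using residue_fibre cd' by simp
    finally show "card {s \<in> ?T. map_prod residue residue s = t} = (card M)\<^sup>2"
      using card_residue_class cd' by (simp add: card_cartesian_product power2_eq_square)
  qed
  also have "card ?S = card ?V * F.num_consecutive" by (rule F.card_unit_power_pairs)
  finally have T: "card ?T = (card M)\<^sup>2 * (card ?V * F.num_consecutive)" .
  have "6 * num_cliques 3 (with_proj (unit_power_graph R k)) = order R * card ?T"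
    unfolding unit_power_graph_def
  proof (rule num_triangles_cayley_graph)
    show "?U \<subseteq> carrier R" by (auto simp: U)
    show "\<zero> \<notin> ?U" using F.zero_notin_unit_powers by (simp add: U residue_zero)
    fix x assume "x \<in> ?U"
    then have x: "x \<in> carrier R" "residue x \<in> carrier residue_field" "residue x \<in> ?V"
      by (auto simp: U residue_closed)
    then have "\<chi> (residue x) = 1" using F.char_eq_1_iff by blast
    then have "\<chi> (\<ominus>\<^bsub>residue_field\<^esub> residue x) = 1" using x F.char_uminus by simp
    then show "\<ominus> x \<in> ?U" using x F.char_eq_1_iff[of "\<ominus>\<^bsub>residue_field\<^esub> residue x"]
      by (simp add: U residue_a_inv)
  qed simp
  then have "6 * k * num_cliques 3 (with_proj (unit_power_graph R k)) = k * (order R * card ?T)"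
    by simp
  also have "\<dots> = order residue_field * card M * (card M)\<^sup>2 * (k * card ?V) * F.num_consecutive"
    unfolding T order_eq by simp
  also have "k * card ?V = order residue_field - 1" by (rule F.card_unit_powers)
  finally show ?thesis by (simp add: power3_eq_cube power2_eq_square)
qed

end

section \<open>The cyclotomic numbers of order three and four\<close>

context power_residue_character
begin

text \<open>For p = 1 modulo 3 the two evaluations of the count give 2 a - b = -C(2n, n) modulo p,
  and the binomial coefficient is prime to p because the base-p digits of n all equal (p -
  1)/3.\<close>

lemma num_consecutive_cubic_eq:
  fixes p r :: nat and c :: int
  assumes k: "k = 3" and p: "prime p" and q: "order R = p ^ r"
    and even: "even (order R) \<Longrightarrow> 3 dvd order R - 1"
    and odd: "odd (order R) \<Longrightarrow> 6 dvd order R - 1"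
    and c1: "[p = 1] (mod 3) \<Longrightarrow>
      (\<exists>d::int. 4 * int (order R) = c\<^sup>2 + 27 * d\<^sup>2) \<and> [c = 1] (mod 3) \<and> \<not> int p dvd c"
    and c2: "[p = 2] (mod 3) \<Longrightarrow> c = - 2 * (- int p) ^ (r div 2)"
  shows "9 * int num_consecutive = int (order R) - 8 + c"
proof -
  have q1: "order R > 1" by (rule order_gt_1)
  have r: "r > 0" using q q1 by (cases r) auto
  have "6 dvd order R - 1 \<Longrightarrow> 3 dvd order R - 1" by (rule dvd_trans[of 3 6]) auto
  then have "3 dvd order R - 1" using even odd by blast
  then obtain n where N: "order R - 1 = 3 * n" by (rule dvdE)
  then have qn: "order R = 3 * n + 1" using q1 by linarith
  then have "[order R = 1] (mod 3)" by (simp add: cong_def)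
  then obtain a b :: int where ab: "int (order R) = a\<^sup>2 - a * b + b\<^sup>2" "3 dvd b"
      "[2 * a - b = 1] (mod 3)" "9 * int num_consecutive = int (order R) - 8 + (2 * a - b)"
    using num_consecutive_cubic[OF k] by blast
  have p3: "\<not> 3 dvd p"
  proof
    assume "3 dvd p"
    then have "3 dvd order R" using q r by (simp add: dvd_trans[OF _ dvd_power])
    then show False using qn by presburger
  qed
  have "c = 2 * a - b"
  proof (rule cubic_representation_determined[OF p p3 q r ab(1-3) _ c1 c2])
    assume p1: "[p = 1] (mod 3)"
    show "\<not> int p dvd 2 * a - b"
    proof
      assume dvd: "int p dvd 2 * a - b"
      have "p = 3 * (p div 3) + 1" using p1 unfolding cong_def by presburger
      then obtain m where m: "p = 3 * m + 1" by blast
      \<comment> \<open>With p odd, 6 divides q - 1 = 3 n, so n is even as the field-valued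
        expansion requires.\<close>
      have "p \<noteq> 2" using m by presburger
      then have "odd p" using p primes_dvd_imp_eq two_is_prime_nat by blast
      then have "odd (order R)" using q by simp
      then have "6 dvd 3 * n" using odd N by simp
      then have n: "even n" by presburger
      have nc: "num_consecutive = card {x \<in> unit_powers R 3. \<one> \<ominus> x \<in> unit_powers R 3}"
        unfolding num_consecutive_def by (simp only: k)
      have "int p dvd int (9 * num_consecutive + 8 + (2 * n choose n))"
        using char_dvd_cubic[OF p q N n] unfolding nc by (simp only: of_nat_dvd_iff)
      moreover have "int (9 * num_consecutive + 8 + (2 * n choose n)) =
          int (order R) + ((2 * a - b) + int (2 * n choose n))"
        using ab(4) by simp
      ultimately have "int p dvd int (order R) + ((2 * a - b) + int (2 * n choose n))" by (simp only:)
      moreover have "int p dvd int (order R)" using q r by (simp add: dvd_power)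
      ultimately have "int p dvd int (2 * n choose n)"
        using dvd by (simp only: dvd_add_right_iff)
      then have "p dvd (2 * n choose n)" by (simp only: of_nat_dvd_iff)
      then show False
        using prime_not_dvd_binomial_digit[OF p m, of r n 1] q qn by (simp add: numeral_2_eq_2)
    qed
  qed
  then show ?thesis using ab(4) by simp
qed

text \<open>For p = 1 modulo 4 the comparison gives 6 a = 3 C(3n, n) modulo p, where the base-p
  digits of n all equal (p - 1)/4.\<close>

lemma num_consecutive_quartic_eq:
  fixes p r :: nat and e f :: int
  assumes k: "k = 4" and p: "prime p" and q: "order R = p ^ r" "[order R = 1] (mod 8)"
    and e: "int (order R) = e\<^sup>2 + 4 * f\<^sup>2" "[e = 1] (mod 4)"
    and e': "[p = 1] (mod 4) \<Longrightarrow> \<not> int p dvd e"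
  shows "16 * int num_consecutive = int (order R) - 11 - 6 * e"
proof -
  have q1: "order R > 1" by (rule order_gt_1)
  have r: "r > 0" using q(1) q1 by (cases r) auto
  have "order R = 8 * (order R div 8) + 1" using q(2) unfolding cong_def by presburger
  then obtain m where m: "order R = 8 * m + 1" by blast
  define n where "n = 2 * m"
  have N: "order R - 1 = 4 * n" "even n" using m by (simp_all add: n_def)
  obtain a b :: int where ab: "int (order R) = a\<^sup>2 + 4 * b\<^sup>2" "[a = 1] (mod 4)"
      "16 * int num_consecutive = int (order R) - 11 - 6 * a"
    using num_consecutive_quartic[OF k q(2)] by blast
  have "odd (order R)" using m by simp
  then have p2: "odd p" using q(1) r by simp
  have "e = a"
  proof (rule quartic_representation_determined[OF p p2 q(1) r ab(1,2) e _ e'])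
    assume p1: "[p = 1] (mod 4)"
    show "\<not> int p dvd a"
    proof
      assume dvd: "int p dvd a"
      have "p = 4 * (p div 4) + 1" using p1 unfolding cong_def by presburger
      then obtain s where s: "p = 4 * s + 1" by blast
      have nc: "num_consecutive = card {x \<in> unit_powers R 4. \<one> \<ominus> x \<in> unit_powers R 4}"
        unfolding num_consecutive_def by (simp only: k)
      have "int p dvd int (16 * num_consecutive + 11 + 3 * (3 * n choose n))"
        using char_dvd_quartic[OF p q(1) N] unfolding nc by (simp only: of_nat_dvd_iff)
      moreover have "int (16 * num_consecutive + 11 + 3 * (3 * n choose n)) =
          int (order R) + (a * (- 6) + int (3 * (3 * n choose n)))"
        using ab(3) by simp
      ultimately have "int p dvd int (order R) + (a * (- 6) + int (3 * (3 * n choose n)))"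
        by (simp only:)
      moreover have "int p dvd int (order R)" using q(1) r by (simp add: dvd_power)
      moreover have "int p dvd a * (- 6)" using dvd by (rule dvd_mult2)
      ultimately have "int p dvd int (3 * (3 * n choose n))"
        by (simp only: dvd_add_right_iff)
      then have "p dvd 3 * (3 * n choose n)" by (simp only: of_nat_dvd_iff)
      then have "p dvd 3 \<or> p dvd (3 * n choose n)" using p prime_dvd_mult_iff by blast
      \<comment> \<open>The prime 3 is not 1 modulo 4, so the factor 3 can be cancelled.\<close>
      moreover have "\<not> p dvd 3"
      proof
        assume "p dvd 3"
        then have "p \<le> 3" by (simp add: dvd_imp_le)
        then have "p = 1" using s by presburger
        then show False using p by simp
      qed
      ultimately have "p dvd (3 * n choose n)" by blast
      then show False
        using prime_not_dvd_binomial_digit[OF p s, of r n 2] q(1) m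
        by (simp add: numeral_3_eq_3 n_def)
    qed
  qed
  then show ?thesis using ab(3) by simp
qed

end

theorem theorem3p1:
  fixes R :: "('a, 'b) ring_scheme" and M :: "'a set" and q \<beta> k :: nat
  assumes "local_ring R M"
    and "finite (carrier R)"
    and "card M = q ^ \<beta>"
    and "order (R Quot M) = q"
    and "odd q \<Longrightarrow> k dvd (q - 1) div 2"
    and "even q \<Longrightarrow> k dvd q - 1"
  shows
    "(k = 2 \<longrightarrow> [q = 1] (mod 4) \<longrightarrow>
       real (num_cliques 3 (with_proj (unit_power_graph R k))) =
         real q ^ (3 * \<beta> + 1) * (real q - 1) * (real q - 5) / 48)
     \<and>
     (k = 3 \<longrightarrow>
       (\<forall>(p::nat) (r::nat) (c::int).
         prime p \<longrightarrow> q = p ^ r \<longrightarrow>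
         (even q \<longrightarrow> 3 dvd q - 1) \<longrightarrow> (odd q \<longrightarrow> 6 dvd q - 1) \<longrightarrow>
         ([p = 1] (mod 3) \<longrightarrow>
            (\<exists>d::int. 4 * int q = c\<^sup>2 + 27 * d\<^sup>2) \<and> [c = 1] (mod 3) \<and> \<not> int p dvd c) \<longrightarrow>
         ([p = 2] (mod 3) \<longrightarrow> c = - 2 * (- int p) ^ (r div 2)) \<longrightarrow>
         real (num_cliques 3 (with_proj (unit_power_graph R k))) =
           real q ^ (3 * \<beta> + 1) * (real q - 1) * (real q + real_of_int c - 8) / 162))
     \<and>
     (k = 4 \<longrightarrow>
       (\<forall>(p::nat) (r::nat) (e::int) (f::int).
         prime p \<longrightarrow> q = p ^ r \<longrightarrow> [q = 1] (mod 8) \<longrightarrow>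
         int q = e\<^sup>2 + 4 * f\<^sup>2 \<longrightarrow> [e = 1] (mod 4) \<longrightarrow>
         ([p = 1] (mod 4) \<longrightarrow> \<not> int p dvd e) \<longrightarrow>
         real (num_cliques 3 (with_proj (unit_power_graph R k))) =
           real q ^ (3 * \<beta> + 1) * (real q - 1) * (real q - 6 * real_of_int e - 11) / (2 ^ 7 * 3)))"
proof (cases "2 \<le> k")
  \<comment> \<open>For k < 2 all three claims are vacuous.\<close>
  case True
  interpret finite_local_ring R M
    using assms(1,2) by (intro finite_local_ring.intro finite_local_ring_axioms.intro)
  interpret F: finite_field residue_field by (rule finite_field_residue_field)
  have q1: "q > 1" using F.order_gt_1 assms(4) by simp
  have kq: "k dvd q - 1"
  proof (cases "even q")
    case False
    then have "even (q - 1)" using q1 by simp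
    then have "(q - 1) div 2 dvd q - 1" by (metis dvd_div_mult_self dvd_triv_left)
    then show ?thesis using assms(5)[OF False] dvd_trans by blast
  qed (rule assms(6))
  \<comment> \<open>Since k divides q - 1 and \<open>card M\<close> is a power of q, k-th powers in
    R are governed by the residue field.\<close>
  have "coprime (q - 1) q" using q1 by (intro coprime_diff_one_left_nat) simp
  then have cop: "coprime k (card M)"
    unfolding assms(3) using kq by (meson coprime_divisors coprime_power_right_iff dvd_refl)
  obtain \<chi> where \<chi>: "power_residue_character residue_field \<chi> k"
    using F.exists_power_residue_character[OF True, unfolded assms(4), OF assms(6,5)] by blast
  interpret C: power_residue_character residue_field \<chi> k by (rule \<chi>)
  have "6 * k * num_cliques 3 (with_proj (unit_power_graph R k)) =
      (q ^ \<beta>) ^ 3 * q * (q - 1) * C.num_consecutive"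
    using num_triangles_unit_power_graph[OF True cop \<chi>] unfolding assms(3,4) .
  also have "(q ^ \<beta>) ^ 3 * q = q ^ (3 * \<beta> + 1)"
    by (simp add: power_mult[symmetric] mult.commute)
  finally have "real (6 * k * num_cliques 3 (with_proj (unit_power_graph R k))) =
      real (q ^ (3 * \<beta> + 1) * (q - 1) * C.num_consecutive)" by simp
  then have "6 * real k * real (num_cliques 3 (with_proj (unit_power_graph R k))) =
      real q ^ (3 * \<beta> + 1) * (real q - 1) * real C.num_consecutive"
    using q1 by (simp add: of_nat_diff)
  \<comment> \<open>The cyclotomic number has denominator k^2, so the final denominators are 6 k^3:
    48, 162 and 384 = 2^7 * 3.\<close>
  then have K: "real (num_cliques 3 (with_proj (unit_power_graph R k))) =
      real q ^ (3 * \<beta> + 1) * (real q - 1) * real C.num_consecutive / (6 * real k)"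
    using True by (simp add: field_simps)
  show ?thesis
  proof (intro conjI impI allI)
    assume k: "k = 2"
    have "real_of_int (4 * int C.num_consecutive) = real_of_int (int q - 5)"
      using C.num_consecutive_quadratic[OF k] assms(4) by simp
    then have nc: "real C.num_consecutive = (real q - 5) / 4" by simp
    then show "real (num_cliques 3 (with_proj (unit_power_graph R k))) =
         real q ^ (3 * \<beta> + 1) * (real q - 1) * (real q - 5) / 48"
      unfolding K nc by (simp add: k)
  next
    fix p r :: nat and c :: int
    assume k: "k = 3" and p: "prime p" "q = p ^ r"
      and q: "even q \<longrightarrow> 3 dvd q - 1" "odd q \<longrightarrow> 6 dvd q - 1"
      and c: "[p = 1] (mod 3) \<longrightarrow>
            (\<exists>d::int. 4 * int q = c\<^sup>2 + 27 * d\<^sup>2) \<and> [c = 1] (mod 3) \<and> \<not> int p dvd c"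
         "[p = 2] (mod 3) \<longrightarrow> c = - 2 * (- int p) ^ (r div 2)"
    have "9 * int C.num_consecutive = int (order residue_field) - 8 + c"
      by (rule C.num_consecutive_cubic_eq[OF k p(1), of r]) (use p q c assms(4) in auto)
    then have "real_of_int (9 * int C.num_consecutive) = real_of_int (int q - 8 + c)"
      using assms(4) by simp
    then have nc: "real C.num_consecutive = (real q + real_of_int c - 8) / 9" by simp
    then show "real (num_cliques 3 (with_proj (unit_power_graph R k))) =
           real q ^ (3 * \<beta> + 1) * (real q - 1) * (real q + real_of_int c - 8) / 162"
      unfolding K nc by (simp add: k)
  next
    fix p r :: nat and e f :: int
    assume k: "k = 4" and p: "prime p" "q = p ^ r" "[q = 1] (mod 8)"
      and e: "int q = e\<^sup>2 + 4 * f\<^sup>2" "[e = 1] (mod 4)" "[p = 1] (mod 4) \<longrightarrow> \<not> int p dvd e"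
    have "16 * int C.num_consecutive = int (order residue_field) - 11 - 6 * e"
      by (rule C.num_consecutive_quartic_eq[OF k p(1), of r e f]) (use p e assms(4) in auto)
    then have "real_of_int (16 * int C.num_consecutive) = real_of_int (int q - 11 - 6 * e)"
      using assms(4) by simp
    then have nc: "real C.num_consecutive = (real q - 6 * real_of_int e - 11) / 16" by simp
    then show "real (num_cliques 3 (with_proj (unit_power_graph R k))) =
           real q ^ (3 * \<beta> + 1) * (real q - 1) * (real q - 6 * real_of_int e - 11) / (2 ^ 7 * 3)"
      unfolding K nc by (simp add: k)
  qed
qed auto

end
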